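(* Let $X$ and $Y$ be Banach spaces such that $X$ has property $(R_p)$ and $Y$ has property $(R_q)$ for some $1<p,q<\infty$ satisfying $1/p+1/q\geq 1$. Then the pair $(X,Y)$ has property (AW).
   Context: All Banach spaces are real; an operator is a continuous linear map between Banach spaces. $X\widehat{\otimes}_\pi Y$ denotes the projective tensor product of $X$ and $Y$. For $W_1\subseteq X$ and $W_2\subseteq Y$, put $W_1\otimes W_2:=\{x\otimes y:\ x\in W_1,\ y\in W_2\}\subseteq X\widehat{\otimes}_\pi Y$. A subset of a Banach space is weakly precompact if every sequence in it admits a weakly Cauchy subsequence. Property $(R_p)$ (for $1<p<\infty$): a Banach space $X$ has property $(R_p)$ if for every relatively weakly compact set $A\subseteq X$ which is not relatively norm compact there is an operator $u:X\to\ell_p$ such that $u(A)$ is not relatively norm compact. Property (AW): the pair $(X,Y)$ of Banach spaces has property (AW) if whenever $W_1\subseteq X$ and $W_2\subseteq Y$ are sets such that $W_1\otimes W_2$ is weakly precompact in $X\widehat{\otimes}_\pi Y$, then either $W_1$ or $W_2$ is relatively norm compact. *)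

theory Defs
  imports "HOL-Analysis.Analysis"
begin

section \<open>Separation of points by bounded functionals\<close>

text \<open>
  Only needed to see that the projective seminorm below is a norm.  The proof takes a minimal
  sublinear functional below a given one.
\<close>

definition sublinear :: "('a::real_vector \<Rightarrow> real) \<Rightarrow> bool" where
  "sublinear q \<longleftrightarrow> (\<forall>x y. q (x + y) \<le> q x + q y) \<and> (\<forall>c x. 0 \<le> c \<longrightarrow> q (c *\<^sub>R x) = c * q x)"

lemma sublinear_add: "sublinear q \<Longrightarrow> q (x + y) \<le> q x + q y"
  and sublinear_scale: "sublinear q \<Longrightarrow> 0 \<le> c \<Longrightarrow> q (c *\<^sub>R x) = c * q x"
  by (auto simp: sublinear_def)

lemma sublinear_zero: "sublinear q \<Longrightarrow> q 0 = 0"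
  using sublinear_scale[of q 0 0] by simp

lemma sublinear_minus: "sublinear q \<Longrightarrow> - q (- x) \<le> q x"
  using sublinear_add[of q x "- x"] sublinear_zero[of q] by simp

lemma sublinear_shift:
  fixes q :: "'a::real_vector \<Rightarrow> real"
  assumes q: "sublinear q"
  obtains r where "sublinear r" "\<And>x. r x \<le> q x" "r (- z) \<le> - q z"
proof -
  define S where "S x = (\<lambda>t. q (x + t *\<^sub>R z) - t * q z) ` {0..}" for x
  define r where "r x = Inf (S x)" for x
  have lb: "- q (- x) \<le> q (x + t *\<^sub>R z) - t * q z" if "0 \<le> t" for x t
    using sublinear_add[OF q, of "x + t *\<^sub>R z" "- x"] sublinear_scale[OF q that, of z] by simp
  have bdd: "bdd_below (S x)" for x
    unfolding S_def by (rule bdd_belowI2[where m = "- q (- x)"]) (use lb in auto)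
  have le: "r x \<le> q (x + t *\<^sub>R z) - t * q z" if "0 \<le> t" for x t
    unfolding r_def by (rule cInf_lower[OF _ bdd]) (use that in \<open>auto simp: S_def\<close>)
  have ge: "m \<le> r x" if "\<And>t. 0 \<le> t \<Longrightarrow> m \<le> q (x + t *\<^sub>R z) - t * q z" for m x
    unfolding r_def by (rule cInf_greatest) (use that in \<open>auto simp: S_def\<close>)
  have sub: "r (x + y) \<le> r x + r y" for x y
  proof -
    have "r (x + y) - (q (x + s *\<^sub>R z) - s * q z) \<le> q (y + t *\<^sub>R z) - t * q z"
      if "0 \<le> s" "0 \<le> t" for s t
    proof -
      have "r (x + y) \<le> q (x + y + (s + t) *\<^sub>R z) - (s + t) * q z"
        by (rule le) (use that in simp)
      moreover have "x + y + (s + t) *\<^sub>R z = (x + s *\<^sub>R z) + (y + t *\<^sub>R z)"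
        by (simp add: algebra_simps)
      ultimately show ?thesis
        using sublinear_add[OF q, of "x + s *\<^sub>R z" "y + t *\<^sub>R z"] by (simp add: algebra_simps)
    qed
    then have "r (x + y) - (q (x + s *\<^sub>R z) - s * q z) \<le> r y" if "0 \<le> s" for s
      using that by (intro ge) auto
    then have "r (x + y) - r y \<le> r x"
      by (intro ge) (simp add: algebra_simps)
    then show ?thesis by simp
  qed
  have hom1: "r (c *\<^sub>R x) \<le> c * r x" if "0 < c" for c x
  proof -
    have "r (c *\<^sub>R x) / c \<le> q (x + t *\<^sub>R z) - t * q z" if "0 \<le> t" for t
    proof -
      have "r (c *\<^sub>R x) \<le> q (c *\<^sub>R x + (c * t) *\<^sub>R z) - (c * t) * q z"
        by (rule le) (use that \<open>0 < c\<close> in simp)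
      also have "c *\<^sub>R x + (c * t) *\<^sub>R z = c *\<^sub>R (x + t *\<^sub>R z)"
        by (simp add: algebra_simps)
      also have "q \<dots> = c * q (x + t *\<^sub>R z)"
        by (rule sublinear_scale[OF q]) (use \<open>0 < c\<close> in simp)
      finally show ?thesis
        using \<open>0 < c\<close> by (simp add: field_simps)
    qed
    then have "r (c *\<^sub>R x) / c \<le> r x" by (rule ge)
    then show ?thesis using that by (simp add: field_simps)
  qed
  have hom: "r (c *\<^sub>R x) = c * r x" if "0 \<le> c" for c x
  proof (cases "c = 0")
    case True
    have "r 0 \<le> 0" using le[of 0 0] sublinear_zero[OF q] by simp
    moreover have "0 \<le> r 0"
      by (rule ge) (simp add: sublinear_scale[OF q])
    ultimately show ?thesis using True by simp
  next
    case False
    with that have c: "0 < c" by simp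
    have "r x \<le> inverse c * r (c *\<^sub>R x)"
      using hom1[of "inverse c" "c *\<^sub>R x"] c by simp
    then have "c * r x \<le> r (c *\<^sub>R x)" using c by (simp add: field_simps)
    with hom1[OF c] show ?thesis by (metis antisym)
  qed
  show thesis
  proof
    show "sublinear r" using sub hom by (auto simp: sublinear_def)
    show "r x \<le> q x" for x using le[of 0 x] by simp
    show "r (- z) \<le> - q z" using le[of 1 "- z"] sublinear_zero[OF q] by simp
  qed
qed

lemma linear_below_sublinear:
  fixes p :: "'a::real_vector \<Rightarrow> real"
  assumes p: "sublinear p"
  obtains f where "linear f" "\<And>x. f x \<le> p x"
proof -
  define A where "A = {q. sublinear q \<and> (\<forall>x. q x \<le> p x)}"
  have po: "partial_order_on A (relation_of (\<lambda>a b. b \<le> a) A)"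
    by (rule partial_order_on_relation_ofI) auto
  have "\<exists>u\<in>A. \<forall>a\<in>C. u \<le> a" if C: "C \<in> Chains (relation_of (\<lambda>a b. b \<le> a) A)" for C
  proof (cases "C = {}")
    case True
    then show ?thesis using p by (auto simp: A_def)
  next
    case False
    have CA: "q \<in> A" if "q \<in> C" for q
      using C that by (auto simp: Chains_def relation_of_def)
    have tot: "q \<le> q' \<or> q' \<le> q" if "q \<in> C" "q' \<in> C" for q q'
      using C that by (auto simp: Chains_def relation_of_def)
    define u where "u x = (INF q\<in>C. q x)" for x
    have bdd: "bdd_below ((\<lambda>q. q x) ` C)" for x
    proof (rule bdd_belowI2[where m = "- p (- x)"])
      fix q assume "q \<in> C"
      then have "sublinear q" "q (- x) \<le> p (- x)" using CA by (auto simp: A_def)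
      then show "- p (- x) \<le> q x" using sublinear_minus[of q x] by linarith
    qed
    have le: "u x \<le> q x" if "q \<in> C" for q x
      unfolding u_def by (rule cINF_lower[OF bdd that])
    have ge: "m \<le> u x" if "\<And>q. q \<in> C \<Longrightarrow> m \<le> q x" for m x
      unfolding u_def by (rule cINF_greatest[OF False that])
    have subl: "sublinear q" if "q \<in> C" for q using CA[OF that] by (simp add: A_def)
    have sub: "u (x + y) \<le> u x + u y" for x y
    proof -
      have "u (x + y) - q x \<le> q' y" if "q \<in> C" "q' \<in> C" for q q'
      proof (cases "q \<le> q'")
        case True
        then have "q y \<le> q' y" by (simp add: le_fun_def)
        with le[OF that(1), of "x + y"] sublinear_add[OF subl[OF that(1)], of x y]
        show ?thesis by linarith
      next
        case False
        then have "q' x \<le> q x" using tot[OF that] by (auto simp: le_fun_def)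
        with le[OF that(2), of "x + y"] sublinear_add[OF subl[OF that(2)], of x y]
        show ?thesis by linarith
      qed
      then have "u (x + y) - q x \<le> u y" if "q \<in> C" for q
        using that by (intro ge) auto
      then have "u (x + y) - u y \<le> u x"
        by (intro ge) (simp add: algebra_simps)
      then show ?thesis by simp
    qed
    have hom1: "u (c *\<^sub>R x) \<le> c * u x" if "0 < c" for c x
    proof -
      have "u (c *\<^sub>R x) / c \<le> u x"
      proof (rule ge)
        fix q assume "q \<in> C"
        then show "u (c *\<^sub>R x) / c \<le> q x"
          using le[of q "c *\<^sub>R x"] sublinear_scale[OF subl, of q c x] that
          by (simp add: field_simps)
      qed
      then show ?thesis using that by (simp add: field_simps)
    qed
    have hom: "u (c *\<^sub>R x) = c * u x" if "0 \<le> c" for c x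
    proof (cases "c = 0")
      case True
      have "u 0 = (INF q\<in>C. 0)"
        unfolding u_def using sublinear_zero[OF subl] by (intro INF_cong) auto
      then show ?thesis using True False by simp
    next
      case False
      with that have c: "0 < c" by simp
      have "u x \<le> inverse c * u (c *\<^sub>R x)"
        using hom1[of "inverse c" "c *\<^sub>R x"] c by simp
      then have "c * u x \<le> u (c *\<^sub>R x)" using c by (simp add: field_simps)
      with hom1[OF c] show ?thesis by (metis antisym)
    qed
    obtain q0 where "q0 \<in> C" using False by auto
    then have "u x \<le> p x" for x
      using le[of q0 x] CA[of q0] by (auto simp: A_def intro: order_trans)
    with sub hom have "u \<in> A" by (auto simp: A_def sublinear_def)
    moreover have "u \<le> a" if "a \<in> C" for a using le[OF that] by (simp add: le_fun_def)
    ultimately show ?thesis by blast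
  qed
  from predicate_Zorn[OF po this] obtain m
    where m: "m \<in> A" and min: "\<And>a. a \<in> A \<Longrightarrow> a \<le> m \<Longrightarrow> a = m" by blast
  have ms: "sublinear m" and mp: "\<And>x. m x \<le> p x" using m by (auto simp: A_def)
  have odd: "m (- z) = - m z" for z
  proof -
    obtain r where r: "sublinear r" "\<And>x. r x \<le> m x" "r (- z) \<le> - m z"
      using sublinear_shift[OF ms] by metis
    have "r \<in> A" using r(1) order_trans[OF r(2) mp] by (simp add: A_def)
    then have "r = m" using r(2) by (intro min) (auto simp: le_fun_def)
    then have "m (- z) \<le> - m z" using r(3) by simp
    with sublinear_minus[OF ms, of z] show ?thesis by linarith
  qed
  have add: "m (x + y) = m x + m y" for x y
    using sublinear_add[OF ms, of x y] sublinear_add[OF ms, of "x + y" "- y"] odd[of y] by simp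
  have scale: "m (c *\<^sub>R x) = c * m x" for c x
  proof (cases "0 \<le> c")
    case True then show ?thesis by (rule sublinear_scale[OF ms])
  next
    case False
    then have "m ((- c) *\<^sub>R x) = (- c) * m x" by (intro sublinear_scale[OF ms]) simp
    then show ?thesis using odd[of "c *\<^sub>R x"] by simp
  qed
  have "linear m" by (rule linearI) (auto simp: add scale)
  then show thesis using mp by (rule that)
qed

lemma bounded_functional_nonzero:
  fixes z :: "'a::real_normed_vector"
  assumes "z \<noteq> 0"
  obtains f :: "'a \<Rightarrow> real" where "bounded_linear f" "f z \<noteq> 0"
proof -
  have "sublinear (norm :: 'a \<Rightarrow> real)" by (auto simp: sublinear_def norm_triangle_ineq)
  then obtain r :: "'a \<Rightarrow> real"
    where r: "sublinear r" "\<And>x. r x \<le> norm x" "r (- z) \<le> - norm z"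
    using sublinear_shift by metis
  obtain f where f: "linear f" "\<And>x. f x \<le> r x"
    using linear_below_sublinear[OF r(1)] by metis
  have up: "f x \<le> norm x" for x using f(2)[of x] r(2)[of x] by linarith
  have "\<bar>f x\<bar> \<le> norm x" for x
    using up[of x] up[of "- x"] linear_neg[OF f(1), of x] by simp
  then have "bounded_linear f"
    using f(1) by (intro bounded_linear_intro[where K = 1])
      (auto simp: linear_add linear_scale)
  moreover have "f (- z) < 0" using f(2)[of "- z"] r(3) assms by (smt (verit) zero_less_norm_iff)
  then have "f z \<noteq> 0" using linear_neg[OF f(1), of z] by simp
  ultimately show thesis by (rule that)
qed


section \<open>The algebraic tensor product with the projective norm\<close>

text \<open>
  An element of the algebraic tensor product is a finite formal sum of elementary tensors, here a
  list of pairs; two sums are the same tensor iff all bilinear forms take the same value on them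
  (bilinear forms separate the points of the algebraic tensor product).
\<close>

definition bilinear_sum :: "('a \<Rightarrow> 'b \<Rightarrow> real) \<Rightarrow> ('a \<times> 'b) list \<Rightarrow> real" where
  "bilinear_sum B ps = (\<Sum>(x, y)\<leftarrow>ps. B x y)"

definition same_tensor :: "('a::real_vector \<times> 'b::real_vector) list \<Rightarrow> ('a \<times> 'b) list \<Rightarrow> bool" where
  "same_tensor ps qs \<longleftrightarrow> (\<forall>B. bilinear B \<longrightarrow> bilinear_sum B ps = bilinear_sum B qs)"

quotient_type (overloaded) ('a, 'b) tensor =
  "('a::real_vector \<times> 'b::real_vector) list" / same_tensor
  morphisms rep_tensor tensor_of
  by (auto intro!: equivpI reflpI sympI transpI simp: same_tensor_def)

lemma bilinear_sum_Nil [simp]: "bilinear_sum B [] = 0"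
  and bilinear_sum_Cons [simp]: "bilinear_sum B ((x, y) # ps) = B x y + bilinear_sum B ps"
  and bilinear_sum_append [simp]: "bilinear_sum B (ps @ qs) = bilinear_sum B ps + bilinear_sum B qs"
  by (auto simp: bilinear_sum_def)

lemma bilinear_sum_scale:
  "bilinear B \<Longrightarrow> bilinear_sum B (map (apfst ((*\<^sub>R) c)) ps) = c * bilinear_sum B ps"
  by (induction ps) (auto simp: algebra_simps bilinear_lmul)

instantiation tensor :: (real_vector, real_vector) real_vector
begin

lift_definition zero_tensor :: "('a, 'b) tensor" is "[]" .

lift_definition plus_tensor :: "('a, 'b) tensor \<Rightarrow> ('a, 'b) tensor \<Rightarrow> ('a, 'b) tensor" is "(@)"
  by (simp add: same_tensor_def)

lift_definition scaleR_tensor :: "real \<Rightarrow> ('a, 'b) tensor \<Rightarrow> ('a, 'b) tensor"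
  is "\<lambda>c. map (apfst ((*\<^sub>R) c))"
  by (simp add: same_tensor_def bilinear_sum_scale)

definition uminus_tensor :: "('a, 'b) tensor \<Rightarrow> ('a, 'b) tensor" where
  "uminus_tensor u = (-1) *\<^sub>R u"

definition minus_tensor :: "('a, 'b) tensor \<Rightarrow> ('a, 'b) tensor \<Rightarrow> ('a, 'b) tensor" where
  "minus_tensor u v = u + - v"

instance
proof
  fix u v w :: "('a, 'b) tensor" and a b :: real
  show "u + v + w = u + (v + w)" by transfer (simp add: same_tensor_def)
  show "u + v = v + u" by transfer (simp add: same_tensor_def)
  show "0 + u = u" by transfer (simp add: same_tensor_def)
  show "- u + u = 0" unfolding uminus_tensor_def
    by transfer (simp add: same_tensor_def bilinear_sum_scale del: apfst_conv)
  show "u - v = u + - v" by (rule minus_tensor_def)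
  show "a *\<^sub>R (u + v) = a *\<^sub>R u + a *\<^sub>R v"
    by transfer (simp add: same_tensor_def)
  show "(a + b) *\<^sub>R u = a *\<^sub>R u + b *\<^sub>R u"
    by transfer (simp add: same_tensor_def bilinear_sum_scale algebra_simps)
  show "a *\<^sub>R b *\<^sub>R u = (a * b) *\<^sub>R u"
    by transfer (simp add: same_tensor_def bilinear_sum_scale del: map_map)
  show "1 *\<^sub>R u = u"
    by transfer (simp add: same_tensor_def bilinear_sum_scale)
qed

end


lemma functionals_separate_tensors:
  fixes ps :: "('a::real_normed_vector \<times> 'b::real_normed_vector) list"
  assumes B: "bilinear B"
    and 0: "\<And>f. bounded_linear f \<Longrightarrow> (\<Sum>(x, y)\<leftarrow>ps. f x *\<^sub>R y) = 0"
  shows "bilinear_sum B ps = 0"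
  using 0
proof (induction "length ps" arbitrary: ps)
  case 0
  then show ?case by simp
next
  case (Suc n)
  then obtain x y qs where ps: "ps = (x, y) # qs" and n: "n = length qs"
    by (cases ps) auto
  show ?case
  proof (cases "x = 0")
    case True
    have "(\<Sum>(x, y)\<leftarrow>qs. f x *\<^sub>R y) = 0" if "bounded_linear f" for f
      using Suc.prems[OF that] linear_0[OF bounded_linear.linear[OF that]] by (simp add: ps True)
    then show ?thesis
      using Suc.hyps(1)[OF n] by (simp add: ps True bilinear_lzero[OF B])
  next
    case False
    then obtain g :: "'a \<Rightarrow> real" where g: "bounded_linear g" "g x \<noteq> 0"
      by (rule bounded_functional_nonzero)
    define h where "h v = v - (g v / g x) *\<^sub>R x" for v
    have y: "g x *\<^sub>R y = - (\<Sum>(x, y)\<leftarrow>qs. g x *\<^sub>R y)"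
      using Suc.prems[OF g(1)] by (simp add: ps add_eq_0_iff2)
    have sum_f: "(\<Sum>(x, y)\<leftarrow>map (apfst h) rs. f x *\<^sub>R y)
        = (\<Sum>(x, y)\<leftarrow>rs. f x *\<^sub>R y) - (f x / g x) *\<^sub>R (\<Sum>(x, y)\<leftarrow>rs. g x *\<^sub>R y)"
      if "bounded_linear f" for f and rs :: "('a \<times> 'b) list"
      by (induction rs)
        (auto simp: h_def linear_diff linear_scale bounded_linear.linear[OF that] algebra_simps)
    have "(\<Sum>(x, y)\<leftarrow>map (apfst h) qs. f x *\<^sub>R y) = 0" if f: "bounded_linear f" for f
    proof -
      have "(\<Sum>(x, y)\<leftarrow>map (apfst h) qs. f x *\<^sub>R y)
          = (\<Sum>(x, y)\<leftarrow>qs. f x *\<^sub>R y) + (f x / g x) *\<^sub>R (g x *\<^sub>R y)"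
        unfolding sum_f[OF f] y by simp
      also have "\<dots> = (\<Sum>(x, y)\<leftarrow>ps. f x *\<^sub>R y)"
        using g(2) by (simp add: ps)
      finally show ?thesis using Suc.prems[OF f] by simp
    qed
    then have "bilinear_sum B (map (apfst h) qs) = 0"
      by (intro Suc.hyps(1)) (simp_all add: n)
    moreover have "bilinear_sum B (map (apfst h) rs)
        = bilinear_sum B rs - B x (\<Sum>(x, y)\<leftarrow>rs. g x *\<^sub>R y) / g x" for rs
    proof (induction rs)
      case Nil
      show ?case by (simp add: bilinear_rzero[OF B])
    next
      case (Cons r rs)
      obtain v w where r: "r = (v, w)" by fastforce
      have "B (h v) w = B v w - g v * B x w / g x"
        by (simp add: h_def bilinear_lsub[OF B] bilinear_lmul[OF B])
      then show ?case
        using Cons.IH by (simp add: r bilinear_radd[OF B] bilinear_rmul[OF B] add_divide_distrib)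
    qed
    moreover have "B x (\<Sum>(x, y)\<leftarrow>qs. g x *\<^sub>R y) = - (g x * B x y)"
    proof -
      have "(\<Sum>(x, y)\<leftarrow>qs. g x *\<^sub>R y) = (- g x) *\<^sub>R y" using y by simp
      then show ?thesis by (simp only: bilinear_rmul[OF B]) simp
    qed
    ultimately show ?thesis
      using g(2) by (simp add: ps)
  qed
qed

definition cost :: "('a::real_normed_vector \<times> 'b::real_normed_vector) list \<Rightarrow> real" where
  "cost ps = (\<Sum>(x, y)\<leftarrow>ps. norm x * norm y)"

lemma cost_Nil [simp]: "cost [] = 0"
  and cost_Cons [simp]: "cost ((x, y) # ps) = norm x * norm y + cost ps"
  and cost_append [simp]: "cost (ps @ qs) = cost ps + cost qs"
  by (auto simp: cost_def)

lemma cost_nonneg [simp]: "0 \<le> cost ps"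
  by (induction ps) auto

lemma cost_scale: "cost (map (apfst ((*\<^sub>R) c)) ps) = \<bar>c\<bar> * cost ps"
  by (induction ps) (auto simp: algebra_simps)

instantiation tensor :: (real_normed_vector, real_normed_vector) real_normed_vector
begin

definition norm_tensor :: "('a, 'b) tensor \<Rightarrow> real" where
  "norm_tensor u = Inf {cost ps | ps. tensor_of ps = u}"

definition dist_tensor :: "('a, 'b) tensor \<Rightarrow> ('a, 'b) tensor \<Rightarrow> real" where
  "dist_tensor u v = norm (u - v)"

definition sgn_tensor :: "('a, 'b) tensor \<Rightarrow> ('a, 'b) tensor" where
  "sgn_tensor u = u /\<^sub>R norm u"

definition uniformity_tensor :: "(('a, 'b) tensor \<times> ('a, 'b) tensor) filter" where
  "uniformity_tensor = (INF e\<in>{0 <..}. principal {(u, v). dist u v < e})"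

definition open_tensor :: "('a, 'b) tensor set \<Rightarrow> bool" where
  "open_tensor U \<longleftrightarrow> (\<forall>u\<in>U. \<forall>\<^sub>F (u', v) in uniformity. u' = u \<longrightarrow> v \<in> U)"

lemma norm_tensor_le: "tensor_of ps = u \<Longrightarrow> norm u \<le> cost ps" for u :: "('a, 'b) tensor"
  unfolding norm_tensor_def by (rule cInf_lower) (auto intro!: bdd_belowI[where m = 0])

lemma norm_tensor_ge:
  "(\<And>ps. tensor_of ps = u \<Longrightarrow> m \<le> cost ps) \<Longrightarrow> m \<le> norm u" for u :: "('a, 'b) tensor"
  unfolding norm_tensor_def
  by (rule cInf_greatest) (use Quotient3_abs_rep[OF Quotient3_tensor, of u] in auto)

lemma norm_tensor_scale_le: "norm (c *\<^sub>R u) \<le> \<bar>c\<bar> * norm u" for u :: "('a, 'b) tensor"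
proof (cases "c = 0")
  case True
  have "0 *\<^sub>R u = tensor_of []"
    using scale_zero_left[of u] by (simp only: zero_tensor.abs_eq)
  then show ?thesis using norm_tensor_le[of "[]" "c *\<^sub>R u"] True by simp
next
  case False
  have "norm (c *\<^sub>R u) / \<bar>c\<bar> \<le> norm u"
  proof (rule norm_tensor_ge)
    fix ps assume "tensor_of ps = u"
    then have "tensor_of (map (apfst ((*\<^sub>R) c)) ps) = c *\<^sub>R u"
      by (metis scaleR_tensor.abs_eq)
    from norm_tensor_le[OF this] show "norm (c *\<^sub>R u) / \<bar>c\<bar> \<le> cost ps"
      using False by (simp add: cost_scale field_simps)
  qed
  then show ?thesis using False by (simp add: field_simps)
qed

instance
proof
  fix u v :: "('a, 'b) tensor" and c :: real
  show "dist u v = norm (u - v)" by (rule dist_tensor_def)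
  show "sgn u = u /\<^sub>R norm u" by (rule sgn_tensor_def)
  show "uniformity = (INF e\<in>{0 <..}. principal {(u, v :: ('a, 'b) tensor). dist u v < e})"
    by (rule uniformity_tensor_def)
  show "open U \<longleftrightarrow> (\<forall>u\<in>U. \<forall>\<^sub>F (u', v) in uniformity. u' = u \<longrightarrow> v \<in> U)"
    for U :: "('a, 'b) tensor set"
    by (rule open_tensor_def)
  show "norm (u + v) \<le> norm u + norm v"
  proof -
    have "norm (u + v) - cost ps \<le> cost qs" if "tensor_of ps = u" "tensor_of qs = v" for ps qs
      using norm_tensor_le[of "ps @ qs" "u + v"] that plus_tensor.abs_eq[of ps qs] by simp
    then have "norm (u + v) - cost ps \<le> norm v" if "tensor_of ps = u" for ps
      using that by (intro norm_tensor_ge) auto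
    then have "norm (u + v) - norm v \<le> norm u"
      by (intro norm_tensor_ge) (simp add: algebra_simps)
    then show ?thesis by simp
  qed
  show "norm (c *\<^sub>R u) = \<bar>c\<bar> * norm u"
  proof (cases "c = 0")
    case True
    then show ?thesis using norm_tensor_scale_le[of c u] norm_tensor_ge[of "c *\<^sub>R u" 0] by simp
  next
    case False
    have "norm u \<le> \<bar>inverse c\<bar> * norm (c *\<^sub>R u)"
      using norm_tensor_scale_le[of "inverse c" "c *\<^sub>R u"] False by simp
    then have "\<bar>c\<bar> * norm u \<le> norm (c *\<^sub>R u)"
      using False by (simp add: field_simps)
    with norm_tensor_scale_le[of c u] show ?thesis by (rule antisym)
  qed
  show "norm u = 0 \<longleftrightarrow> u = 0"
  proof
    assume "u = 0"
    then show "norm u = 0"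
      using norm_tensor_le[of "[]" u] norm_tensor_ge[of u 0] by (simp add: zero_tensor.abs_eq)
  next
    assume u: "norm u = 0"
    obtain ps where ps: "tensor_of ps = u"
      using Quotient3_abs_rep[OF Quotient3_tensor] by metis
    have "(\<Sum>(x, y)\<leftarrow>ps. f x *\<^sub>R y) = 0" if f: "bounded_linear f" for f
    proof (rule ccontr)
      assume "(\<Sum>(x, y)\<leftarrow>ps. f x *\<^sub>R y) \<noteq> 0"
      then obtain g :: "'b \<Rightarrow> real"
        where g: "bounded_linear g" "g (\<Sum>(x, y)\<leftarrow>ps. f x *\<^sub>R y) \<noteq> 0"
        by (rule bounded_functional_nonzero)
      define B where "B = (\<lambda>x y. f x * g y)"
      have B: "bilinear B"
        unfolding bilinear_def B_def
        using bounded_linear.linear[OF f] bounded_linear.linear[OF g(1)]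
        by (auto intro!: linearI simp: linear_add linear_scale algebra_simps)
      obtain K where K: "0 < K" "\<And>x. norm (f x) \<le> norm x * K"
        using bounded_linear.pos_bounded[OF f] by blast
      obtain L where L: "0 < L" "\<And>y. norm (g y) \<le> norm y * L"
        using bounded_linear.pos_bounded[OF g(1)] by blast
      have bound: "\<bar>bilinear_sum B qs\<bar> \<le> K * L * cost qs" for qs
      proof (induction qs)
        case (Cons q qs)
        obtain x y where q: "q = (x, y)" by fastforce
        have "\<bar>B x y\<bar> \<le> (norm x * K) * (norm y * L)"
          unfolding B_def abs_mult using K L by (intro mult_mono) auto
        then show ?case using Cons.IH by (simp add: q algebra_simps)
      qed simp
      have "\<bar>bilinear_sum B ps\<bar> / (K * L) \<le> norm u"
      proof (rule norm_tensor_ge)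
        fix qs :: "('a \<times> 'b) list" assume "tensor_of qs = u"
        then have "same_tensor qs ps" using ps tensor.abs_eq_iff by metis
        then have "bilinear_sum B qs = bilinear_sum B ps" using B by (simp add: same_tensor_def)
        then show "\<bar>bilinear_sum B ps\<bar> / (K * L) \<le> cost qs"
          using bound[of qs] K(1) L(1) by (simp add: field_simps)
      qed
      then have "bilinear_sum B ps = 0"
        using u K(1) L(1) by (simp add: field_simps)
      moreover have "g (\<Sum>(x, y)\<leftarrow>qs. f x *\<^sub>R y) = bilinear_sum B qs" for qs
        using bounded_linear.linear[OF g(1)]
        by (induction qs) (auto simp: B_def linear_add linear_scale linear_0)
      ultimately show False using g(2) by simp
    qed
    then have "bilinear_sum B ps = 0" if "bilinear B" for B
      by (rule functionals_separate_tensors[OF that])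
    then have "same_tensor ps []" by (simp add: same_tensor_def)
    then show "u = 0" using ps by (metis tensor.abs_eq_iff zero_tensor.abs_eq)
  qed
qed

end


section \<open>Completion of a normed space\<close>

lemma Cauchy_const: "Cauchy (\<lambda>_. c :: 'a::real_normed_vector)"
  by (simp add: Cauchy_iff)

lemma Cauchy_add:
  fixes s t :: "nat \<Rightarrow> 'a::real_normed_vector"
  assumes "Cauchy s" "Cauchy t"
  shows "Cauchy (\<lambda>n. s n + t n)"
proof (rule CauchyI)
  fix e :: real assume e: "0 < e"
  obtain M where M: "\<And>m n. M \<le> m \<Longrightarrow> M \<le> n \<Longrightarrow> norm (s m - s n) < e / 2"
    using CauchyD[OF assms(1), of "e / 2"] e by auto
  obtain N where N: "\<And>m n. N \<le> m \<Longrightarrow> N \<le> n \<Longrightarrow> norm (t m - t n) < e / 2"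
    using CauchyD[OF assms(2), of "e / 2"] e by auto
  have "norm ((s m + t m) - (s n + t n)) < e" if "max M N \<le> m" "max M N \<le> n" for m n
  proof -
    have "(s m + t m) - (s n + t n) = (s m - s n) + (t m - t n)" by simp
    also have "norm \<dots> \<le> norm (s m - s n) + norm (t m - t n)" by (rule norm_triangle_ineq)
    also have "\<dots> < e" using M[of m n] N[of m n] that by simp
    finally show ?thesis .
  qed
  then show "\<exists>M. \<forall>m\<ge>M. \<forall>n\<ge>M. norm ((s m + t m) - (s n + t n)) < e" by blast
qed

lemma Cauchy_scaleR:
  fixes s :: "nat \<Rightarrow> 'a::real_normed_vector"
  assumes "Cauchy s"
  shows "Cauchy (\<lambda>n. c *\<^sub>R s n)"
  using bounded_linear.Cauchy[OF bounded_linear_scaleR_right[of c] assms] .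

lemma Cauchy_minus: "Cauchy s \<Longrightarrow> Cauchy (\<lambda>n. - s n)" for s :: "nat \<Rightarrow> 'a::real_normed_vector"
  using Cauchy_scaleR[of s "-1"] by simp

lemma Cauchy_diff:
  "Cauchy s \<Longrightarrow> Cauchy t \<Longrightarrow> Cauchy (\<lambda>n. s n - t n)" for s t :: "nat \<Rightarrow> 'a::real_normed_vector"
  using Cauchy_add[of s "\<lambda>n. - t n"] Cauchy_minus[of t] by simp

definition same_limit :: "(nat \<Rightarrow> 'a::real_normed_vector) \<Rightarrow> (nat \<Rightarrow> 'a) \<Rightarrow> bool" where
  "same_limit s t \<longleftrightarrow> Cauchy s \<and> Cauchy t \<and> (\<lambda>n. s n - t n) \<longlonglongrightarrow> 0"

lemma part_equivp_same_limit: "part_equivp (same_limit :: (nat \<Rightarrow> 'a::real_normed_vector) \<Rightarrow> _)"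
proof (rule part_equivpI)
  show "\<exists>s. same_limit s s"
    by (rule exI[of _ "\<lambda>_. 0"]) (simp add: same_limit_def Cauchy_const)
  show "symp same_limit"
    by (rule sympI) (auto simp: same_limit_def dest: tendsto_minus)
  show "transp (same_limit :: (nat \<Rightarrow> 'a) \<Rightarrow> _)"
  proof (rule transpI)
    fix s t r :: "nat \<Rightarrow> 'a" assume *: "same_limit s t" "same_limit t r"
    then have "(\<lambda>n. (s n - t n) + (t n - r n)) \<longlonglongrightarrow> 0 + 0"
      unfolding same_limit_def by (intro tendsto_add) auto
    then show "same_limit s r" using * by (simp add: same_limit_def)
  qed
qed

quotient_type (overloaded) 'a completion = "nat \<Rightarrow> 'a::real_normed_vector" / partial: same_limit
  morphisms rep_completion limit_of
  by (rule part_equivp_same_limit)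

lemma Cauchy_norm: "Cauchy s \<Longrightarrow> Cauchy (\<lambda>n. norm (s n))"
  unfolding Cauchy_iff by (metis norm_triangle_ineq3 order_le_less_trans real_norm_def)

lemma same_limit_norm:
  assumes "same_limit s t"
  shows "lim (\<lambda>n. norm (s n)) = lim (\<lambda>n. norm (t n))"
proof -
  have "(\<lambda>n. norm (s n)) \<longlonglongrightarrow> lim (\<lambda>n. norm (s n))"
    using assms by (simp add: same_limit_def Cauchy_norm Cauchy_convergent flip: convergent_LIMSEQ_iff)
  moreover have "(\<lambda>n. norm (s n) - norm (t n)) \<longlonglongrightarrow> 0"
  proof (rule Lim_null_comparison)
    show "\<forall>\<^sub>F n in sequentially. norm (norm (s n) - norm (t n)) \<le> norm (s n - t n)"
      by (simp add: norm_triangle_ineq3)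
    show "(\<lambda>n. norm (s n - t n)) \<longlonglongrightarrow> 0"
      using assms by (simp add: same_limit_def tendsto_norm_zero)
  qed
  ultimately have "(\<lambda>n. norm (t n)) \<longlonglongrightarrow> lim (\<lambda>n. norm (s n))"
    by (drule_tac tendsto_diff) (assumption, simp)
  then show ?thesis by (simp add: limI)
qed

instantiation completion :: (real_normed_vector) real_normed_vector
begin

lift_definition zero_completion :: "'a completion" is "\<lambda>_. 0"
  by (simp add: same_limit_def Cauchy_const)

lift_definition plus_completion :: "'a completion \<Rightarrow> 'a completion \<Rightarrow> 'a completion"
  is "\<lambda>s t n. s n + t n"
  by (auto simp: same_limit_def Cauchy_add add_diff_add intro: tendsto_add_zero)

lift_definition uminus_completion :: "'a completion \<Rightarrow> 'a completion" is "\<lambda>s n. - s n"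
  by (auto simp: same_limit_def Cauchy_minus dest: tendsto_minus)

lift_definition minus_completion :: "'a completion \<Rightarrow> 'a completion \<Rightarrow> 'a completion"
  is "\<lambda>s t n. s n - t n"
proof -
  fix s t s' t' :: "nat \<Rightarrow> 'a" assume *: "same_limit s t" "same_limit s' t'"
  then have "(\<lambda>n. (s n - t n) - (s' n - t' n)) \<longlonglongrightarrow> 0 - 0"
    unfolding same_limit_def by (intro tendsto_diff) auto
  moreover have "(s n - t n) - (s' n - t' n) = (s n - s' n) - (t n - t' n)" for n by simp
  ultimately show "same_limit (\<lambda>n. s n - s' n) (\<lambda>n. t n - t' n)"
    using * by (auto simp: same_limit_def Cauchy_diff)
qed

lift_definition scaleR_completion :: "real \<Rightarrow> 'a completion \<Rightarrow> 'a completion"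
  is "\<lambda>c s n. c *\<^sub>R s n"
proof -
  fix c and s t :: "nat \<Rightarrow> 'a" assume *: "same_limit s t"
  then have "(\<lambda>n. c *\<^sub>R (s n - t n)) \<longlonglongrightarrow> c *\<^sub>R 0"
    unfolding same_limit_def by (intro tendsto_intros) auto
  then show "same_limit (\<lambda>n. c *\<^sub>R s n) (\<lambda>n. c *\<^sub>R t n)"
    using * by (auto simp: same_limit_def Cauchy_scaleR scaleR_diff_right)
qed

lift_definition norm_completion :: "'a completion \<Rightarrow> real" is "\<lambda>s. lim (\<lambda>n. norm (s n))"
  by (rule same_limit_norm)

definition dist_completion :: "'a completion \<Rightarrow> 'a completion \<Rightarrow> real" where
  "dist_completion x y = norm (x - y)"

definition sgn_completion :: "'a completion \<Rightarrow> 'a completion" where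
  "sgn_completion x = inverse (norm x) *\<^sub>R x"

definition uniformity_completion :: "('a completion \<times> 'a completion) filter" where
  "uniformity_completion = (INF e\<in>{0 <..}. principal {(x, y). dist x y < e})"

definition open_completion :: "'a completion set \<Rightarrow> bool" where
  "open_completion U \<longleftrightarrow> (\<forall>x\<in>U. \<forall>\<^sub>F (x', y) in uniformity. x' = x \<longrightarrow> y \<in> U)"

lemma tendsto_norm_rep:
  "same_limit s s \<Longrightarrow> (\<lambda>n. norm (s n)) \<longlonglongrightarrow> lim (\<lambda>n. norm (s n))" for s :: "nat \<Rightarrow> 'a"
  by (simp add: same_limit_def Cauchy_norm Cauchy_convergent flip: convergent_LIMSEQ_iff)

instance
proof
  fix x y z :: "'a completion" and a b :: real
  show "x + y + z = x + (y + z)"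
    by transfer (simp add: same_limit_def Cauchy_add algebra_simps)
  show "x + y = y + x"
    by transfer (simp add: same_limit_def Cauchy_add algebra_simps)
  show "0 + x = x" by transfer (simp add: same_limit_def)
  show "- x + x = 0" by transfer (simp add: same_limit_def Cauchy_const)
  show "x - y = x + - y"
    by transfer (simp add: same_limit_def Cauchy_diff)
  show "a *\<^sub>R (x + y) = a *\<^sub>R x + a *\<^sub>R y"
    by transfer (simp add: same_limit_def Cauchy_add Cauchy_scaleR algebra_simps)
  show "(a + b) *\<^sub>R x = a *\<^sub>R x + b *\<^sub>R x"
    by transfer (simp add: same_limit_def Cauchy_add Cauchy_scaleR algebra_simps)
  show "a *\<^sub>R b *\<^sub>R x = (a * b) *\<^sub>R x"
    by transfer (simp add: same_limit_def Cauchy_scaleR)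
  show "1 *\<^sub>R x = x" by transfer (simp add: same_limit_def)
  show "dist x y = norm (x - y)" by (rule dist_completion_def)
  show "sgn x = inverse (norm x) *\<^sub>R x" by (rule sgn_completion_def)
  show "uniformity = (INF e\<in>{0 <..}. principal {(x, y :: 'a completion). dist x y < e})"
    by (rule uniformity_completion_def)
  show "open U \<longleftrightarrow> (\<forall>x\<in>U. \<forall>\<^sub>F (x', y) in uniformity. x' = x \<longrightarrow> y \<in> U)"
    for U :: "'a completion set"
    by (rule open_completion_def)
  show "norm x = 0 \<longleftrightarrow> x = 0"
  proof transfer
    fix s :: "nat \<Rightarrow> 'a" assume s: "same_limit s s"
    show "lim (\<lambda>n. norm (s n)) = 0 \<longleftrightarrow> same_limit s (\<lambda>_. 0)"
    proof
      assume "lim (\<lambda>n. norm (s n)) = 0"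
      then show "same_limit s (\<lambda>_. 0)"
        using s tendsto_norm_rep[OF s]
          by (simp add: same_limit_def Cauchy_const tendsto_norm_zero_iff)
    next
      assume "same_limit s (\<lambda>_. 0)"
      then show "lim (\<lambda>n. norm (s n)) = 0" using same_limit_norm[of s "\<lambda>_. 0"] by simp
    qed
  qed
  show "norm (x + y) \<le> norm x + norm y"
  proof transfer
    fix s t :: "nat \<Rightarrow> 'a" assume s: "same_limit s s" and t: "same_limit t t"
    have "same_limit (\<lambda>n. s n + t n) (\<lambda>n. s n + t n)"
      using s t by (simp add: same_limit_def Cauchy_add)
    from tendsto_norm_rep[OF this] tendsto_add[OF tendsto_norm_rep[OF s] tendsto_norm_rep[OF t]]
    show "lim (\<lambda>n. norm (s n + t n)) \<le> lim (\<lambda>n. norm (s n)) + lim (\<lambda>n. norm (t n))"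
      by (rule LIMSEQ_le) (auto simp: norm_triangle_ineq)
  qed
  show "norm (a *\<^sub>R x) = \<bar>a\<bar> * norm x"
  proof transfer
    fix a :: real and s :: "nat \<Rightarrow> 'a" assume s: "same_limit s s"
    from tendsto_mult_left[OF tendsto_norm_rep[OF s], of "\<bar>a\<bar>"]
    show "lim (\<lambda>n. norm (a *\<^sub>R s n)) = \<bar>a\<bar> * lim (\<lambda>n. norm (s n))"
      by (intro limI) simp
  qed
qed

end

lift_definition embed :: "'a::real_normed_vector \<Rightarrow> 'a completion" is "\<lambda>x _. x"
  by (simp add: same_limit_def Cauchy_const)

lemma norm_embed [simp]: "norm (embed x) = norm x"
  by transfer simp

lemma embed_diff: "embed (x - y) = embed x - embed y"
  by transfer (simp add: same_limit_def Cauchy_const)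

lemma embed_tendsto:
  assumes s: "Cauchy s"
  shows "(\<lambda>n. embed (s n)) \<longlonglongrightarrow> limit_of s"
proof (rule metric_LIMSEQ_I)
  fix e :: real assume "0 < e"
  obtain N where N: "\<And>m n. N \<le> m \<Longrightarrow> N \<le> n \<Longrightarrow> norm (s m - s n) < e / 2"
    using CauchyD[OF s, of "e / 2"] \<open>0 < e\<close> by auto
  have "dist (embed (s n)) (limit_of s) < e" if n: "N \<le> n" for n
  proof -
    have *: "same_limit (\<lambda>k. s n - s k) (\<lambda>k. s n - s k)"
      using s by (simp add: same_limit_def Cauchy_diff Cauchy_const)
    have "embed (s n) - limit_of s = limit_of (\<lambda>k. s n - s k)"
      using s by (simp add: embed.abs_eq minus_completion.abs_eq same_limit_def Cauchy_const)
    then have "dist (embed (s n)) (limit_of s) = lim (\<lambda>k. norm (s n - s k))"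
      using * by (simp add: dist_norm norm_completion.abs_eq)
    also have "\<dots> \<le> e / 2"
      using N n by (intro LIMSEQ_le_const2[OF tendsto_norm_rep[OF *]]) (auto intro: less_imp_le)
    finally show ?thesis using \<open>0 < e\<close> by simp
  qed
  then show "\<exists>N. \<forall>n\<ge>N. dist (embed (s n)) (limit_of s) < e" by blast
qed

lemma embed_dense:
  assumes "0 < e"
  obtains x where "dist (embed x) \<xi> < e"
proof -
  obtain s where s: "Cauchy s" "limit_of s = \<xi>"
    using Quotient3_completion
    by (metis Quotient3_abs_rep Quotient3_rep_reflp same_limit_def)
  from metric_LIMSEQ_D[OF embed_tendsto[OF s(1)] assms] s(2) that show thesis by blast
qed

instance completion :: (real_normed_vector) banach
proof
  fix X :: "nat \<Rightarrow> 'a completion" assume X: "Cauchy X"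
  have "\<exists>x. dist (embed x) (X n) < inverse (Suc n)" for n
    by (rule embed_dense[of "inverse (Suc n)" "X n"]) auto
  then obtain s where s: "\<And>n. dist (embed (s n)) (X n) < inverse (Suc n)" by metis
  have close: "(\<lambda>n. embed (s n) - X n) \<longlonglongrightarrow> 0"
    by (rule Lim_null_comparison[OF _ LIMSEQ_inverse_real_of_nat])
      (use s in \<open>auto simp: dist_norm intro!: always_eventually less_imp_le\<close>)
  then have "Cauchy (\<lambda>n. (embed (s n) - X n) + X n)"
    by (intro Cauchy_add X convergent_Cauchy convergentI)
  then have "Cauchy s"
    by (simp add: Cauchy_iff flip: embed_diff)
  from tendsto_diff[OF embed_tendsto[OF this] close] show "convergent X"
    by (auto simp: convergent_def)
qed


section \<open>The projective tensor product\<close>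

text \<open>The type \<open>tensor\<close> carries the projective norm, so its completion is the projective tensor product.\<close>

type_synonym ('a, 'b) projective_tensor = "('a, 'b) tensor completion"

definition elementary_tensor :: "'a::real_normed_vector \<Rightarrow> 'b::real_normed_vector \<Rightarrow> ('a, 'b) projective_tensor"
    (infixr \<open>\<otimes>\<^sub>\<pi>\<close> 75) where
  "x \<otimes>\<^sub>\<pi> y = embed (tensor_of [(x, y)])"


section \<open>Relative compactness and weak precompactness\<close>

definition relatively_compactin :: "'a topology \<Rightarrow> 'a set \<Rightarrow> bool" where
  "relatively_compactin T A \<longleftrightarrow> compactin T (T closure_of A)"

definition weak_topology :: "'a::real_normed_vector topology" where
  "weak_topology =
    topology_generated_by {f -` U | f U. bounded_linear (f :: 'a \<Rightarrow> real) \<and> open U}"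

definition weakly_Cauchy :: "(nat \<Rightarrow> 'a::real_normed_vector) \<Rightarrow> bool" where
  "weakly_Cauchy s \<longleftrightarrow> (\<forall>f :: 'a \<Rightarrow> real. bounded_linear f \<longrightarrow> Cauchy (\<lambda>n. f (s n)))"

definition weakly_precompact :: "'a::real_normed_vector set \<Rightarrow> bool" where
  "weakly_precompact A \<longleftrightarrow>
    (\<forall>s. range s \<subseteq> A \<longrightarrow> (\<exists>r. strict_mono (r :: nat \<Rightarrow> nat) \<and> weakly_Cauchy (s \<circ> r)))"


section \<open>The sequence spaces\<close>

definition lp_space :: "real \<Rightarrow> (nat \<Rightarrow> real) set" where
  "lp_space p = {x. summable (\<lambda>n. \<bar>x n\<bar> powr p)}"

definition lp_norm :: "real \<Rightarrow> (nat \<Rightarrow> real) \<Rightarrow> real" where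
  "lp_norm p x = (\<Sum>n. \<bar>x n\<bar> powr p) powr (1 / p)"

definition lp_dist :: "real \<Rightarrow> (nat \<Rightarrow> real) \<Rightarrow> (nat \<Rightarrow> real) \<Rightarrow> real" where
  "lp_dist p x y = lp_norm p (\<lambda>n. x n - y n)"

text \<open>
  The space depends on the real number \<open>p\<close>, so it is a carrier set of sequences and not a type.  That
  \<open>lp_dist p\<close> is a metric on it, as \<open>Metric_space.mtopology\<close> needs, is \<open>Metric_space_lp\<close> below.
\<close>

definition lp_topology :: "real \<Rightarrow> (nat \<Rightarrow> real) topology" where
  "lp_topology p = Metric_space.mtopology (lp_space p) (lp_dist p)"

lemma lp_norm_nonneg: "0 \<le> lp_norm p x"
  by (simp add: lp_norm_def)

lemma lp_norm_powr:
  assumes "1 \<le> p" "x \<in> lp_space p"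
  shows "lp_norm p x powr p = (\<Sum>n. \<bar>x n\<bar> powr p)"
  using assms by (simp add: lp_norm_def lp_space_def powr_powr suminf_nonneg)

lemma lp_norm_eq_0:
  assumes "1 \<le> p" "x \<in> lp_space p"
  shows "lp_norm p x = 0 \<longleftrightarrow> (\<forall>n. x n = 0)"
proof -
  have "lp_norm p x = 0 \<longleftrightarrow> (\<Sum>n. \<bar>x n\<bar> powr p) = 0"
    by (simp add: lp_norm_def)
  also have "\<dots> \<longleftrightarrow> (\<forall>n. x n = 0)"
    using assms by (subst suminf_eq_zero_iff) (auto simp: lp_space_def)
  finally show ?thesis .
qed

lemma powr_convex_combination:
  fixes u v t p :: real
  assumes p: "1 \<le> p" and uv: "0 \<le> u" "0 \<le> v" and t: "0 < t" "t < 1"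
  shows "((1 - t) * u + t * v) powr p \<le> (1 - t) * u powr p + t * v powr p"
proof -
  have le: "(c * w) powr p \<le> c * w powr p" if "0 < c" "c < 1" "0 \<le> w" for c w :: real
  proof -
    have "c powr p \<le> c powr 1" using that p by (intro powr_mono') auto
    then show ?thesis using that by (simp add: powr_mult mult_right_mono)
  qed
  consider "u = 0" | "v = 0" | "0 < u" "0 < v" using uv by fastforce
  then show ?thesis
  proof cases
    case 1 then show ?thesis using le[of t v] t uv by simp
  next
    case 2 then show ?thesis using le[of "1 - t" u] t uv by simp
  next
    case 3
    then show ?thesis
      using convex_onD[OF powr_convex[OF p], of t u v] t by simp
  qed
qed

lemma Minkowski:
  assumes p: "1 \<le> p" and x: "x \<in> lp_space p" and y: "y \<in> lp_space p"
  shows "(\<lambda>n. x n + y n) \<in> lp_space p \<and> lp_norm p (\<lambda>n. x n + y n) \<le> lp_norm p x + lp_norm p y"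
proof -
  define a b where "a = lp_norm p x" and "b = lp_norm p y"
  have "0 \<le> a" "0 \<le> b" by (auto simp: a_def b_def lp_norm_nonneg)
  then consider "a = 0" | "b = 0" | "0 < a" "0 < b" by fastforce
  then show ?thesis
  proof cases
    case 1
    then have "\<forall>n. x n = 0" using lp_norm_eq_0[OF p x] by (simp add: a_def)
    then show ?thesis using y 1 by (simp add: a_def lp_norm_nonneg)
  next
    case 2
    then have "\<forall>n. y n = 0" using lp_norm_eq_0[OF p y] by (simp add: b_def)
    then show ?thesis using x 2 by (simp add: b_def lp_norm_nonneg)
  next
    case 3
    define t where "t = b / (a + b)"
    have t: "0 < t" "t < 1" "1 - t = a / (a + b)" using 3 by (auto simp: t_def field_simps)
    define c where "c n = (a + b) powr p *
      ((1 - t) * (\<bar>x n\<bar> powr p / a powr p) + t * (\<bar>y n\<bar> powr p / b powr p))" for n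
    have bound: "\<bar>x n + y n\<bar> powr p \<le> c n" for n
    proof -
      have "(a + b) * ((1 - t) * (\<bar>x n\<bar> / a) + t * (\<bar>y n\<bar> / b)) = \<bar>x n\<bar> + \<bar>y n\<bar>"
        unfolding t(3) unfolding t_def using 3 by (simp add: distrib_left)
      then have "\<bar>x n + y n\<bar> \<le> (a + b) * ((1 - t) * (\<bar>x n\<bar> / a) + t * (\<bar>y n\<bar> / b))"
        by (simp add: abs_triangle_ineq)
      then have "\<bar>x n + y n\<bar> powr p \<le> \<dots> powr p"
        using p by (intro powr_mono2) auto
      also have "\<dots> = (a + b) powr p * ((1 - t) * (\<bar>x n\<bar> / a) + t * (\<bar>y n\<bar> / b)) powr p"
        by (rule powr_mult)
      also have "\<dots> \<le> (a + b) powr p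
          * ((1 - t) * (\<bar>x n\<bar> / a) powr p + t * (\<bar>y n\<bar> / b) powr p)"
        using 3 t p by (intro mult_left_mono powr_convex_combination) auto
      also have "\<dots> = c n" using 3 by (simp add: c_def powr_divide)
      finally show ?thesis .
    qed
    have sx: "(\<lambda>n. \<bar>x n\<bar> powr p) sums (a powr p)"
      using lp_norm_powr[OF p x] x by (simp add: a_def lp_space_def summable_sums)
    have sy: "(\<lambda>n. \<bar>y n\<bar> powr p) sums (b powr p)"
      using lp_norm_powr[OF p y] y by (simp add: b_def lp_space_def summable_sums)
    have "c sums ((a + b) powr p * ((1 - t) * (a powr p / a powr p) + t * (b powr p / b powr p)))"
      unfolding c_def by (intro sums_mult sums_add sums_divide sx sy)
    then have c: "c sums ((a + b) powr p)" using 3 by simp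
    have s: "summable (\<lambda>n. \<bar>x n + y n\<bar> powr p)"
      by (rule summable_comparison_test'[OF sums_summable[OF c]]) (use bound in simp)
    have "(\<Sum>n. \<bar>x n + y n\<bar> powr p) \<le> (a + b) powr p"
      using suminf_le[OF bound s sums_summable[OF c]] sums_unique[OF c] by simp
    then have "lp_norm p (\<lambda>n. x n + y n) \<le> ((a + b) powr p) powr (1 / p)"
      unfolding lp_norm_def using p s by (intro powr_mono2) (auto intro: suminf_nonneg)
    also have "\<dots> = a + b" using p 3 by (simp add: powr_powr)
    finally show ?thesis using s by (simp add: lp_space_def a_def b_def)
  qed
qed

lemma lp_space_diff:
  assumes "1 \<le> p" "x \<in> lp_space p" "y \<in> lp_space p"
  shows "(\<lambda>n. x n - y n) \<in> lp_space p"
proof -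
  have "(\<lambda>n. - y n) \<in> lp_space p" using assms(3) by (simp add: lp_space_def)
  from Minkowski[OF assms(1,2) this] show ?thesis by simp
qed

lemma Metric_space_lp:
  assumes p: "1 \<le> p"
  shows "Metric_space (lp_space p) (lp_dist p)"
proof
  fix x y z
  show "0 \<le> lp_dist p x y" by (simp add: lp_dist_def lp_norm_nonneg)
  show "lp_dist p x y = lp_dist p y x"
    by (simp add: lp_dist_def lp_norm_def abs_minus_commute)
  assume x: "x \<in> lp_space p" and y: "y \<in> lp_space p"
  show "lp_dist p x y = 0 \<longleftrightarrow> x = y"
    using lp_norm_eq_0[OF p lp_space_diff[OF p x y]] by (auto simp: lp_dist_def)
  assume z: "z \<in> lp_space p"
  show "lp_dist p x z \<le> lp_dist p x y + lp_dist p y z"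
    using Minkowski[OF p lp_space_diff[OF p x y] lp_space_diff[OF p y z]]
    by (simp add: lp_dist_def)
qed


section \<open>The properties (R) and (AW)\<close>

text \<open>The vector space operations of the sequence spaces are the pointwise ones.\<close>

definition lp_operator :: "real \<Rightarrow> ('a::real_normed_vector \<Rightarrow> nat \<Rightarrow> real) \<Rightarrow> bool" where
  "lp_operator p u \<longleftrightarrow>
    (\<forall>n. linear (\<lambda>x. u x n)) \<and> continuous_map euclidean (lp_topology p) u"

definition property_R :: "real \<Rightarrow> 'a::banach itself \<Rightarrow> bool" where
  "property_R p X \<longleftrightarrow>
    (\<forall>A :: 'a set. relatively_compactin weak_topology A \<and> \<not> relatively_compactin euclidean A \<longrightarrow>
      (\<exists>u. lp_operator p u \<and> \<not> relatively_compactin (lp_topology p) (u ` A)))"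

definition property_AW :: "'a::banach itself \<Rightarrow> 'b::banach itself \<Rightarrow> bool" where
  "property_AW X Y \<longleftrightarrow>
    (\<forall>(W\<^sub>1 :: 'a set) (W\<^sub>2 :: 'b set). weakly_precompact {x \<otimes>\<^sub>\<pi> y | x y. x \<in> W\<^sub>1 \<and> y \<in> W\<^sub>2} \<longrightarrow>
      relatively_compactin euclidean W\<^sub>1 \<or> relatively_compactin euclidean W\<^sub>2)"

end

theory Submission
  imports Defs
begin

text \<open>
  Suppose that neither \<open>W\<^sub>1\<close> nor \<open>W\<^sub>2\<close> is relatively norm compact although \<open>W\<^sub>1 \<otimes> W\<^sub>2\<close> is weakly
  precompact.  Fixing a nonzero vector in one factor shows that \<open>W\<^sub>1\<close> and \<open>W\<^sub>2\<close> are themselves weakly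
  precompact.  So \<open>W\<^sub>1\<close> contains a weakly Cauchy sequence that is not norm Cauchy, and differences of
  its terms form a weakly null sequence \<open>d\<^sub>n = x\<^sub>n - x'\<^sub>n\<close> bounded away from zero.  The range of such a
  sequence is relatively weakly compact and not relatively norm compact, hence property \<open>(R\<^sub>p)\<close> yields
  an operator into \<open>\<ell>\<^sub>p\<close> under which \<open>d\<^sub>n\<close> does not tend to zero in norm.

  Its coordinates do tend to zero along \<open>d\<^sub>n\<close>, so after passing to a subsequence the images live
  essentially on disjoint blocks of coordinates (\<open>gliding_hump\<close>).  A functional that attains the
  norm of the block part gives \<open>\<phi>\<^sub>i\<close> with \<open>\<phi>\<^sub>i d\<^sub>i \<ge> 1\<close>, with \<open>\<Sum>\<^sub>k |\<phi>\<^sub>k d\<^sub>i|\<^sup>p\<close> small when \<open>k = i\<close> is left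
  out, and with \<open>x \<mapsto> (\<phi>\<^sub>k x)\<^sub>k\<close> still an operator into \<open>\<ell>\<^sub>p\<close>.  The same construction on the
  second factor gives differences \<open>e\<^sub>n = y\<^sub>n - y'\<^sub>n\<close> and functionals \<open>\<psi>\<^sub>k\<close> with exponent \<open>q\<close>.

  For \<open>1/p + 1/q \<ge> 1\<close> the product of a sequence in \<open>\<ell>\<^sub>p\<close> and one in \<open>\<ell>\<^sub>q\<close> is summable, so for all
  weights \<open>\<theta>\<^sub>k\<close> in \<open>[-1, 1]\<close> the diagonal form \<open>\<Sum>\<^sub>k \<theta>\<^sub>k \<phi>\<^sub>k(x) \<psi>\<^sub>k(y)\<close> is a bounded bilinear form and
  hence a bounded functional on the projective tensor product.  Its value at \<open>d\<^sub>n \<otimes> e\<^sub>n\<close> is within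
  \<open>1/4\<close> of \<open>\<theta>\<^sub>n \<phi>\<^sub>n(d\<^sub>n) \<psi>\<^sub>n(e\<^sub>n)\<close>.  As \<open>d\<^sub>n \<otimes> e\<^sub>n\<close> is a combination of four sequences in \<open>W\<^sub>1 \<otimes> W\<^sub>2\<close>, it has
  a weakly Cauchy subsequence; letting \<open>\<theta>\<close> alternate between \<open>1\<close> and \<open>0\<close> along that subsequence
  makes the values of the form oscillate, a contradiction.
\<close>


section \<open>Bounded bilinear forms as functionals on the projective tensor product\<close>

text \<open>
  The extension is the limit of the values along any Cauchy sequence that represents the point;
  equivalent sequences differ by a null sequence, which a bounded functional maps to a null
  sequence.
\<close>

lemma bounded_functional_on_completion:
  fixes l :: "'a::real_normed_vector \<Rightarrow> real"
  assumes l: "bounded_linear l"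
  obtains L where "bounded_linear L" "\<And>x. L (embed x) = l x"
proof -
  define L where "L \<xi> = lim (\<lambda>n. l (rep_completion \<xi> n))" for \<xi> :: "'a completion"
  have lin: "linear l" using l by (rule bounded_linear.linear)
  obtain K where K: "0 < K" "\<And>x. norm (l x) \<le> norm x * K"
    using bounded_linear.pos_bounded[OF l] by blast
  have L: "(\<lambda>n. l (s n)) \<longlonglongrightarrow> L (limit_of s)" if s: "Cauchy s" for s
  proof -
    define t where "t = rep_completion (limit_of s)"
    have "same_limit t s"
      unfolding t_def
      by (rule rep_abs_rsp_left[OF Quotient3_completion]) (use s in \<open>simp add: same_limit_def\<close>)
    then have t: "Cauchy t" "(\<lambda>n. t n - s n) \<longlonglongrightarrow> 0" by (auto simp: same_limit_def)
    have "(\<lambda>n. l (t n)) \<longlonglongrightarrow> L (limit_of s)"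
      using bounded_linear.Cauchy[OF l t(1)]
      by (simp add: L_def t_def Cauchy_convergent flip: convergent_LIMSEQ_iff)
    moreover have "(\<lambda>n. l (t n - s n)) \<longlonglongrightarrow> 0"
      using bounded_linear.tendsto_zero[OF l t(2)] .
    ultimately have "(\<lambda>n. l (t n) - l (t n - s n)) \<longlonglongrightarrow> L (limit_of s) - 0"
      by (rule tendsto_diff)
    then show ?thesis by (simp add: linear_diff[OF lin])
  qed
  have rep: "\<exists>s. Cauchy s \<and> limit_of s = \<xi>" for \<xi> :: "'a completion"
    using Quotient3_completion
    by (metis Quotient3_abs_rep Quotient3_rep_reflp same_limit_def)
  have "bounded_linear L"
  proof (rule bounded_linear_intro[where K = K])
    fix \<xi> \<eta> :: "'a completion" and c :: real
    obtain s t where s: "Cauchy s" "limit_of s = \<xi>" and t: "Cauchy t" "limit_of t = \<eta>"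
      using rep by metis
    have "limit_of (\<lambda>n. s n + t n) = \<xi> + \<eta>"
      using s t by (auto simp: plus_completion.abs_eq same_limit_def)
    with L[OF Cauchy_add[OF s(1) t(1)]] tendsto_add[OF L[OF s(1)] L[OF t(1)]]
    show "L (\<xi> + \<eta>) = L \<xi> + L \<eta>"
      by (simp add: linear_add[OF lin] s t LIMSEQ_unique)
    have "limit_of (\<lambda>n. c *\<^sub>R s n) = c *\<^sub>R \<xi>"
      using s by (auto simp: scaleR_completion.abs_eq same_limit_def)
    with L[OF Cauchy_scaleR[OF s(1)]] tendsto_mult_left[OF L[OF s(1)], of c]
    show "L (c *\<^sub>R \<xi>) = c *\<^sub>R L \<xi>"
      by (simp add: linear_scale[OF lin] s) (metis LIMSEQ_unique)
    have ss: "same_limit s s" using s by (simp add: same_limit_def)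
    have "(\<lambda>n. norm (s n)) \<longlonglongrightarrow> norm \<xi>"
      using tendsto_norm_rep[OF ss] ss by (simp add: s(2)[symmetric] norm_completion.abs_eq)
    from LIMSEQ_le[OF tendsto_norm[OF L[OF s(1)]] tendsto_mult_right[OF this, of K]] K(2)
    show "norm (L \<xi>) \<le> norm \<xi> * K" by (auto simp: s(2))
  qed
  moreover have "L (embed x) = l x" for x
    using L[OF Cauchy_const[of x]] by (simp add: embed.abs_eq LIMSEQ_const_iff)
  ultimately show thesis by (rule that)
qed

text \<open>
  A representation of a tensor as a sum bounds the value of the form by its constant times the cost
  of the representation, so the projective norm, an infimum of costs, is exactly what makes the
  induced functional bounded.
\<close>

lemma bounded_bilinear_on_projective_tensor:
  fixes B :: "'a::real_normed_vector \<Rightarrow> 'b::real_normed_vector \<Rightarrow> real"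
  assumes B: "bounded_bilinear B"
  obtains L where "bounded_linear L" "\<And>x y. L (x \<otimes>\<^sub>\<pi> y) = B x y"
proof -
  interpret bounded_bilinear B by (rule B)
  obtain K where K: "0 < K" "\<And>x y. norm (B x y) \<le> norm x * norm y * K" using pos_bounded by blast
  have bil: "bilinear B"
    by (auto simp: bilinear_def intro!: linearI simp: add_left add_right scaleR_left scaleR_right)
  define l where "l u = bilinear_sum B (rep_tensor u)" for u
  have l: "l (tensor_of ps) = bilinear_sum B ps" for ps
  proof -
    have "same_tensor (rep_tensor (tensor_of ps)) ps"
      using Quotient3_abs_rep[OF Quotient3_tensor] tensor.abs_eq_iff by metis
    then show ?thesis using bil by (simp add: l_def same_tensor_def)
  qed
  have rep: "\<exists>ps. tensor_of ps = u" for u :: "('a, 'b) tensor"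
    using Quotient3_abs_rep[OF Quotient3_tensor] by metis
  have cost: "\<bar>bilinear_sum B ps\<bar> \<le> K * cost ps" for ps
  proof (induction ps)
    case (Cons r ps)
    obtain x y where r: "r = (x, y)" by fastforce
    show ?case using Cons.IH K(2)[of x y] by (simp add: r algebra_simps)
  qed simp
  have bl: "bounded_linear l"
  proof (rule bounded_linear_intro[where K = K])
    fix u v :: "('a, 'b) tensor" and c :: real
    obtain ps qs where "tensor_of ps = u" "tensor_of qs = v" using rep by metis
    then show "l (u + v) = l u + l v" and "l (c *\<^sub>R u) = c *\<^sub>R l u"
      using l bil by (auto simp: plus_tensor.abs_eq scaleR_tensor.abs_eq bilinear_sum_scale)
    have "\<bar>l u\<bar> / K \<le> norm u"
      by (rule norm_tensor_ge) (use l cost K(1) in \<open>auto simp: field_simps\<close>)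
    then show "norm (l u) \<le> norm u * K" using K(1) by (simp add: field_simps)
  qed
  obtain L where L: "bounded_linear L" "\<And>u. L (embed u) = l u"
    by (rule bounded_functional_on_completion[OF bl]) (rule that)
  show thesis by (rule that[OF L(1)]) (simp add: elementary_tensor_def l L(2))
qed


section \<open>Relative compactness and the weak topology\<close>

text \<open>
  Used for the weak topology and for the norm topology of \<open>\<ell>\<^sub>p\<close>: the sequence together with its limit
  is compact, and the Hausdorff property makes it closed.
\<close>

lemma relatively_compactin_sequence:
  assumes T: "Hausdorff_space T" and lim: "limitin T s l sequentially" and s: "range s \<subseteq> topspace T"
  shows "relatively_compactin T (range s)"
proof -
  have c: "compactin T (insert l (range s))"
    by (rule compactin_sequence_with_limit[OF lim]) (use s in auto)
  have "T closure_of range s \<subseteq> insert l (range s)"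
    by (rule closure_of_minimal) (use compactin_imp_closedin[OF T c] in auto)
  then show ?thesis
    unfolding relatively_compactin_def by (rule closed_compactin[OF c]) auto
qed

lemma openin_weak: "bounded_linear f \<Longrightarrow> open U \<Longrightarrow> openin weak_topology (f -` U)"
  for f :: "'a::real_normed_vector \<Rightarrow> real"
  unfolding weak_topology_def by (rule topology_generated_by_Basis) auto

lemma topspace_weak [simp]: "topspace weak_topology = UNIV"
proof -
  have "openin weak_topology ((\<lambda>_::'a. 0::real) -` UNIV)"
    by (rule openin_weak) auto
  then show ?thesis using openin_subset by fastforce
qed

lemma Hausdorff_weak_topology: "Hausdorff_space (weak_topology :: 'a::real_normed_vector topology)"
  unfolding Hausdorff_space_def
proof (intro allI impI, elim conjE)
  fix x y :: 'a assume "x \<noteq> y"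
  then obtain f :: "'a \<Rightarrow> real" where f: "bounded_linear f" "f (x - y) \<noteq> 0"
    using bounded_functional_nonzero[of "x - y"] by auto
  then have "f x \<noteq> f y" using linear_diff[OF bounded_linear.linear] by fastforce
  then obtain U V where "open U" "open V" "f x \<in> U" "f y \<in> V" "U \<inter> V = {}"
    using hausdorff[of "f x" "f y"] by blast
  then show "\<exists>U V. openin weak_topology U \<and> openin weak_topology V \<and> x \<in> U \<and> y \<in> V \<and> disjnt U V"
    by (intro exI[of _ "f -` U"] exI[of _ "f -` V"]) (auto simp: openin_weak f disjnt_def)
qed

text \<open>
  The weak topology is only given by a subbase; the property "\<open>s\<close> is eventually in \<open>V\<close> if \<open>l\<close> is"
  passes from the subbasic sets to finite intersections and arbitrary unions.
\<close>

lemma limitin_weak_topology: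
  fixes s :: "nat \<Rightarrow> 'a::real_normed_vector"
  assumes lim: "\<And>f :: 'a \<Rightarrow> real. bounded_linear f \<Longrightarrow> (\<lambda>n. f (s n)) \<longlonglongrightarrow> f l"
  shows "limitin weak_topology s l sequentially"
  unfolding limitin_def
proof (intro conjI allI impI)
  fix V assume V: "openin weak_topology V \<and> l \<in> V"
  then have "generate_topology_on {f -` U | f U. bounded_linear (f :: 'a \<Rightarrow> real) \<and> open U} V"
    by (simp add: weak_topology_def openin_topology_generated_by_iff)
  then have "l \<in> V \<longrightarrow> eventually (\<lambda>n. s n \<in> V) sequentially"
  proof induction
    case (Int a b) then show ?case by (auto intro: eventually_conj)
  next
    case (UN K)
    have "eventually (\<lambda>n. s n \<in> \<Union>K) sequentially" if k: "k \<in> K" "l \<in> k" for k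
      by (rule eventually_mono[OF UN.IH[OF k(1), THEN mp, OF k(2)]]) (use k in blast)
    then show ?case by blast
  next
    case (Basis V)
    then show ?case using topological_tendstoD[OF lim] by auto
  qed simp
  then show "eventually (\<lambda>n. s n \<in> V) sequentially" using V by simp
qed simp

lemma not_relatively_compact_sequence:
  fixes W :: "'a::banach set"
  assumes "\<not> relatively_compactin euclidean W"
  obtains s :: "nat \<Rightarrow> 'a" where "range s \<subseteq> W" "\<And>r. strict_mono r \<Longrightarrow> \<not> Cauchy (s \<circ> r)"
proof -
  have "Met_TC.mcomplete (TYPE('a))" by (simp add: complete_UNIV)
  then have "\<not> Met_TC.mtotally_bounded W"
    using assms Met_TC.mtotally_bounded_eq_compact_closure_of[of W]
    by (simp add: relatively_compactin_def)
  then obtain s :: "nat \<Rightarrow> 'a" where "range s \<subseteq> W" "\<forall>r. strict_mono r \<longrightarrow> \<not> Cauchy (s \<circ> r)"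
    unfolding Met_TC.mtotally_bounded_sequentially by auto
  then show thesis using that by blast
qed


section \<open>Weakly precompact sets and weakly null differences\<close>

lemma weakly_precompact_pullback:
  fixes W :: "'a::real_normed_vector set" and A :: "'b::real_normed_vector set"
  assumes A: "weakly_precompact A" and h: "h ` W \<subseteq> A"
    and ext: "\<And>f :: 'a \<Rightarrow> real. bounded_linear f \<Longrightarrow> \<exists>L. bounded_linear L \<and> (\<forall>w. L (h w) = f w)"
  shows "weakly_precompact W"
  unfolding weakly_precompact_def
proof (intro allI impI)
  fix s :: "nat \<Rightarrow> 'a" assume "range s \<subseteq> W"
  then have "range (\<lambda>n. h (s n)) \<subseteq> A" using h by auto
  then obtain r where r: "strict_mono (r :: nat \<Rightarrow> nat)" "weakly_Cauchy ((\<lambda>n. h (s n)) \<circ> r)"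
    using A unfolding weakly_precompact_def by blast
  have "weakly_Cauchy (s \<circ> r)"
    unfolding weakly_Cauchy_def
  proof (intro allI impI)
    fix f :: "'a \<Rightarrow> real" assume "bounded_linear f"
    then obtain L where "bounded_linear L" "\<And>w. L (h w) = f w" using ext by blast
    then show "Cauchy (\<lambda>n. f ((s \<circ> r) n))"
      using r(2) by (auto simp: weakly_Cauchy_def)
  qed
  then show "\<exists>r. strict_mono (r :: nat \<Rightarrow> nat) \<and> weakly_Cauchy (s \<circ> r)" using r(1) by blast
qed

text \<open>
  Freezing one variable at a nonzero vector embeds the other factor into the tensor product; a
  functional \<open>f\<close> of the free variable extends to the tensor product as \<open>f \<otimes> g\<close>, where \<open>g\<close> takes the
  value \<open>1\<close> at the frozen vector.
\<close>

lemma weakly_precompact_tensor_factors: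
  fixes W\<^sub>1 :: "'a::real_normed_vector set" and W\<^sub>2 :: "'b::real_normed_vector set"
  assumes W: "weakly_precompact {x \<otimes>\<^sub>\<pi> y | x y. x \<in> W\<^sub>1 \<and> y \<in> W\<^sub>2}"
  shows "y \<in> W\<^sub>2 \<Longrightarrow> y \<noteq> 0 \<Longrightarrow> weakly_precompact W\<^sub>1"
    and "x \<in> W\<^sub>1 \<Longrightarrow> x \<noteq> 0 \<Longrightarrow> weakly_precompact W\<^sub>2"
proof -
  assume y: "y \<in> W\<^sub>2" "y \<noteq> 0"
  obtain g :: "'b \<Rightarrow> real" where g: "bounded_linear g" "g y \<noteq> 0"
    using bounded_functional_nonzero[OF y(2)] by blast
  show "weakly_precompact W\<^sub>1"
  proof (rule weakly_precompact_pullback[OF W, where h = "\<lambda>x. x \<otimes>\<^sub>\<pi> y"])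
    fix f :: "'a \<Rightarrow> real" assume f: "bounded_linear f"
    have "bounded_bilinear (\<lambda>x z. f x * (g z / g y))"
      by (rule bounded_bilinear.comp[OF bounded_bilinear_mult f
            bounded_linear_compose[OF bounded_linear_divide g(1)]])
    then obtain L where "bounded_linear L" "\<And>x z. L (x \<otimes>\<^sub>\<pi> z) = f x * (g z / g y)"
      by (rule bounded_bilinear_on_projective_tensor) (rule that)
    then show "\<exists>L. bounded_linear L \<and> (\<forall>w. L (w \<otimes>\<^sub>\<pi> y) = f w)" using g(2) by auto
  qed (use y in auto)
next
  assume x: "x \<in> W\<^sub>1" "x \<noteq> 0"
  obtain g :: "'a \<Rightarrow> real" where g: "bounded_linear g" "g x \<noteq> 0"
    using bounded_functional_nonzero[OF x(2)] by blast
  show "weakly_precompact W\<^sub>2"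
  proof (rule weakly_precompact_pullback[OF W, where h = "\<lambda>y. x \<otimes>\<^sub>\<pi> y"])
    fix f :: "'b \<Rightarrow> real" assume f: "bounded_linear f"
    have "bounded_bilinear (\<lambda>z y. (g z / g x) * f y)"
      by (rule bounded_bilinear.comp[OF bounded_bilinear_mult
            bounded_linear_compose[OF bounded_linear_divide g(1)] f])
    then obtain L where "bounded_linear L" "\<And>z y. L (z \<otimes>\<^sub>\<pi> y) = (g z / g x) * f y"
      by (rule bounded_bilinear_on_projective_tensor) (rule that)
    then show "\<exists>L. bounded_linear L \<and> (\<forall>w. L (x \<otimes>\<^sub>\<pi> w) = f w)" using g(2) by auto
  qed (use x in auto)
qed

definition weakly_null :: "(nat \<Rightarrow> 'a::real_normed_vector) \<Rightarrow> bool" where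
  "weakly_null d \<longleftrightarrow> (\<forall>f :: 'a \<Rightarrow> real. bounded_linear f \<longrightarrow> (\<lambda>n. f (d n)) \<longlonglongrightarrow> 0)"

text \<open>
  Some sequence in the set has no norm Cauchy subsequence but does have a weakly Cauchy one.  Two
  terms far out in the latter are weakly close to each other and can still be chosen at norm
  distance at least \<open>e\<close>.
\<close>

lemma weakly_null_differences:
  fixes W :: "'a::banach set"
  assumes W: "weakly_precompact W" and nc: "\<not> relatively_compactin euclidean W"
  obtains x x' e where "\<And>n. x n \<in> W" "\<And>n. x' n \<in> W" "weakly_null (\<lambda>n. x n - x' n)"
    "0 < e" "\<And>n. e \<le> norm (x n - x' n)"
proof -
  obtain s :: "nat \<Rightarrow> 'a" where s: "range s \<subseteq> W" "\<And>r. strict_mono r \<Longrightarrow> \<not> Cauchy (s \<circ> r)"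
    using not_relatively_compact_sequence[OF nc] by blast
  obtain r where r: "strict_mono (r :: nat \<Rightarrow> nat)" "weakly_Cauchy (s \<circ> r)"
    using W s(1) unfolding weakly_precompact_def by blast
  define t where "t = s \<circ> r"
  have "\<not> Cauchy t" using s(2) r(1) by (simp add: t_def)
  then obtain e where e: "0 < e" "\<And>N. \<exists>m\<ge>N. \<exists>n\<ge>N. \<not> norm (t m - t n) < e"
    unfolding Cauchy_iff by blast
  then obtain m n where mn: "\<And>N. N \<le> m N" "\<And>N. N \<le> n N" "\<And>N. e \<le> norm (t (m N) - t (n N))"
    by (metis not_less)
  have "weakly_null (\<lambda>N. t (m N) - t (n N))"
    unfolding weakly_null_def
  proof (intro allI impI LIMSEQ_I)
    fix f :: "'a \<Rightarrow> real" and \<epsilon> :: real assume f: "bounded_linear f" and "0 < \<epsilon>"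
    then obtain M where M: "\<And>i j. M \<le> i \<Longrightarrow> M \<le> j \<Longrightarrow> norm (f (t i) - f (t j)) < \<epsilon>"
      using r(2) unfolding t_def weakly_Cauchy_def by (metis CauchyD)
    have "norm (f (t (m N) - t (n N)) - 0) < \<epsilon>" if "M \<le> N" for N
      using M[of "m N" "n N"] mn(1,2)[of N] that
      by (simp add: linear_diff[OF bounded_linear.linear[OF f]])
    then show "\<exists>no. \<forall>N\<ge>no. norm (f (t (m N) - t (n N)) - 0) < \<epsilon>" by blast
  qed
  then show thesis
    using that[of "\<lambda>N. t (m N)" "\<lambda>N. t (n N)" e] e(1) mn(3) s(1) by (auto simp: t_def)
qed

lemma weakly_null_relatively_weakly_compact:
  "weakly_null d \<Longrightarrow> relatively_compactin weak_topology (range d)"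
  by (rule relatively_compactin_sequence[OF Hausdorff_weak_topology limitin_weak_topology[of d 0]])
    (auto simp: weakly_null_def linear_0 bounded_linear.linear)

text \<open>
  A norm limit of a subsequence would also be its weak limit \<open>0\<close>, but has norm at least \<open>e\<close>.
\<close>

lemma weakly_null_not_relatively_compact:
  assumes d: "weakly_null d" and e: "0 < e" "\<And>n. e \<le> norm (d n)"
  shows "\<not> relatively_compactin euclidean (range d)"
proof
  assume "relatively_compactin euclidean (range d)"
  then have "compact (closure (range d))" by (simp add: relatively_compactin_def)
  moreover have "\<forall>n. d n \<in> closure (range d)" using closure_subset[of "range d"] by auto
  ultimately obtain l r where r: "strict_mono (r :: nat \<Rightarrow> nat)" "(d \<circ> r) \<longlonglongrightarrow> l"
    unfolding compact_def by blast
  have "l = 0"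
  proof (rule ccontr)
    assume "l \<noteq> 0"
    then obtain f :: "'a \<Rightarrow> real" where f: "bounded_linear f" "f l \<noteq> 0"
      using bounded_functional_nonzero by blast
    have "(\<lambda>n. f (d n)) \<longlonglongrightarrow> 0" using d f(1) by (simp add: weakly_null_def)
    then have "(\<lambda>n. f ((d \<circ> r) n)) \<longlonglongrightarrow> 0"
      using LIMSEQ_subseq_LIMSEQ[OF _ r(1)] by (fastforce simp: o_def)
    moreover have "(\<lambda>n. f ((d \<circ> r) n)) \<longlonglongrightarrow> f l"
      by (rule bounded_linear.tendsto[OF f(1) r(2)])
    ultimately show False using f(2) LIMSEQ_unique by blast
  qed
  moreover have "e \<le> norm l"
    by (rule LIMSEQ_le_const[OF tendsto_norm[OF r(2)]]) (use e(2) in auto)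
  ultimately show False using e(1) by simp
qed


section \<open>Operators into the sequence spaces by coordinates\<close>

text \<open>
  Bounded operators into \<open>\<ell>\<^sub>p\<close>, given by their coordinate functionals.  Finite sums replace the norm
  of \<open>\<ell>\<^sub>p\<close>, so that no summability has to be carried along.
\<close>

definition lp_coordinates :: "real \<Rightarrow> (nat \<Rightarrow> 'a::real_normed_vector \<Rightarrow> real) \<Rightarrow> bool" where
  "lp_coordinates p g \<longleftrightarrow> (\<forall>k. linear (g k)) \<and>
    (\<exists>C\<ge>0. \<forall>z F. finite F \<longrightarrow> (\<Sum>k\<in>F. \<bar>g k z\<bar> powr p) \<le> (C * norm z) powr p)"

lemma lp_coordinates_bounded_linear:
  assumes g: "lp_coordinates p g" and p: "0 < p"
  shows "bounded_linear (g k)"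
proof -
  obtain C where C: "0 \<le> C" "\<And>z F. finite F \<Longrightarrow> (\<Sum>k\<in>F. \<bar>g k z\<bar> powr p) \<le> (C * norm z) powr p"
    using g unfolding lp_coordinates_def by blast
  have lin: "linear (g k)" using g by (simp add: lp_coordinates_def)
  have "\<bar>g k z\<bar> \<le> C * norm z" for z
  proof (rule ccontr)
    assume "\<not> ?thesis"
    then have "(C * norm z) powr p < \<bar>g k z\<bar> powr p"
      using C(1) p by (intro powr_less_mono2) auto
    then show False using C(2)[of "{k}" z] by simp
  qed
  then show ?thesis
    by (intro bounded_linear_intro[where K = C])
      (auto simp: linear_add[OF lin] linear_scale[OF lin] mult.commute)
qed

lemma lp_coordinates_summable:
  assumes "lp_coordinates p g"
  shows "summable (\<lambda>k. \<bar>g k z\<bar> powr p)"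
  using assms unfolding lp_coordinates_def
  by (auto intro!: bounded_imp_summable)

lemma lp_coordinates_scale:
  assumes "lp_coordinates p g" "0 \<le> c"
  shows "lp_coordinates p (\<lambda>k z. c * g k z)"
proof -
  obtain C where C: "0 \<le> C" "\<And>z F. finite F \<Longrightarrow> (\<Sum>k\<in>F. \<bar>g k z\<bar> powr p) \<le> (C * norm z) powr p"
    using assms unfolding lp_coordinates_def by blast
  have "(\<Sum>k\<in>F. \<bar>c * g k z\<bar> powr p) \<le> (c * C * norm z) powr p" if "finite F" for F z
  proof -
    have "(\<Sum>k\<in>F. \<bar>c * g k z\<bar> powr p) = c powr p * (\<Sum>k\<in>F. \<bar>g k z\<bar> powr p)"
      using assms(2) by (simp add: abs_mult powr_mult sum_distrib_left)
    also have "\<dots> \<le> c powr p * (C * norm z) powr p"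
      by (intro mult_left_mono C(2) that) simp
    finally show ?thesis using assms(2) C(1) by (simp add: powr_mult)
  qed
  moreover have "linear (\<lambda>z. c * g k z)" for k
    using assms(1)
    by (auto simp: lp_coordinates_def linear_add linear_scale algebra_simps intro!: linearI)
  ultimately show ?thesis
    using C(1) assms(2) unfolding lp_coordinates_def by (intro conjI allI exI[of _ "c * C"]) auto
qed

lemma lp_operator_coordinates:
  fixes u :: "'a::real_normed_vector \<Rightarrow> nat \<Rightarrow> real"
  assumes u: "lp_operator p u" and p: "1 \<le> p"
  shows "lp_coordinates p (\<lambda>k z. u z k)"
proof -
  interpret M: Metric_space "lp_space p" "lp_dist p" by (rule Metric_space_lp[OF p])
  have lin: "linear (\<lambda>z. u z k)" for k using u by (simp add: lp_operator_def)
  have cont: "continuous_map euclidean M.mtopology u"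
    using u by (simp add: lp_operator_def lp_topology_def)
  have mem: "u z \<in> lp_space p" for z
    using continuous_map_image_subset_topspace[OF cont] by auto
  have zero: "u 0 = (\<lambda>_. 0)" using linear_0[OF lin] by auto
  have "open {z. u z \<in> M.mball (u 0) 1}"
    using openin_continuous_map_preimage[OF cont M.openin_mball] by simp
  moreover have "0 \<in> {z. u z \<in> M.mball (u 0) 1}" using mem by simp
  ultimately obtain \<rho> where \<rho>: "0 < \<rho>" "\<And>z. dist z 0 < \<rho> \<Longrightarrow> u z \<in> M.mball (u 0) 1"
    unfolding open_dist by blast
  have small: "(\<Sum>k\<in>F. \<bar>u z k\<bar> powr p) \<le> 1" if "finite F" "norm z < \<rho>" for F z
  proof -
    have "lp_norm p (u z) \<le> 1"
      using \<rho>(2)[of z] that by (simp add: lp_dist_def lp_norm_def zero)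
    then have "lp_norm p (u z) powr p \<le> 1 powr p"
      using p by (intro powr_mono2) (auto simp: lp_norm_nonneg)
    then have "(\<Sum>k. \<bar>u z k\<bar> powr p) \<le> 1" by (simp add: lp_norm_powr[OF p mem])
    moreover have "(\<Sum>k\<in>F. \<bar>u z k\<bar> powr p) \<le> (\<Sum>k. \<bar>u z k\<bar> powr p)"
      using mem[of z] that(1) by (intro sum_le_suminf) (auto simp: lp_space_def)
    ultimately show ?thesis by linarith
  qed
  have "(\<Sum>k\<in>F. \<bar>u z k\<bar> powr p) \<le> (2 / \<rho> * norm z) powr p" if F: "finite F" for F z
  proof (cases "z = 0")
    case True
    then show ?thesis by (simp add: zero)
  next
    case False
    define c where "c = \<rho> / (2 * norm z)"
    have c: "0 < c" "1 / c = 2 / \<rho> * norm z" using \<rho>(1) False by (auto simp: c_def)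
    have "norm (c *\<^sub>R z) < \<rho>" using c(1) \<rho>(1) False by (simp add: c_def)
    from small[OF F this] have "c powr p * (\<Sum>k\<in>F. \<bar>u z k\<bar> powr p) \<le> 1"
      using c(1) by (simp add: linear_scale[OF lin] abs_mult powr_mult sum_distrib_left)
    then have "(\<Sum>k\<in>F. \<bar>u z k\<bar> powr p) \<le> 1 / c powr p" using c(1) by (simp add: field_simps)
    also have "\<dots> = (1 / c) powr p" by (simp add: powr_divide)
    finally show ?thesis by (simp add: c(2))
  qed
  then show ?thesis
    using lin \<rho>(1) unfolding lp_coordinates_def by (intro conjI allI exI[of _ "2 / \<rho>"]) auto
qed

text \<open>
  If the images of \<open>d\<close> converged to zero in \<open>\<ell>\<^sub>p\<close>, their range would be relatively compact.  So their
  norms exceed a positive bound infinitely often, and scaling the operator turns the bound on the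
  \<open>p\<close>-th powers into \<open>2\<close>.
\<close>

lemma property_R_coordinates:
  fixes d :: "nat \<Rightarrow> 'a::banach"
  assumes R: "property_R p TYPE('a)" and p: "1 \<le> p"
    and d: "weakly_null d" and e: "0 < e" "\<And>n. e \<le> norm (d n)"
  obtains g where "lp_coordinates p g" "\<And>N. \<exists>n\<ge>N. 2 \<le> (\<Sum>k. \<bar>g k (d n)\<bar> powr p)"
proof -
  obtain u where u: "lp_operator p u" and nc: "\<not> relatively_compactin (lp_topology p) (u ` range d)"
    using R weakly_null_relatively_weakly_compact[OF d] weakly_null_not_relatively_compact[OF d e]
    unfolding property_R_def by blast
  interpret M: Metric_space "lp_space p" "lp_dist p" by (rule Metric_space_lp[OF p])
  have co: "lp_coordinates p (\<lambda>k z. u z k)" by (rule lp_operator_coordinates[OF u p])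
  have mem: "u z \<in> lp_space p" for z
    using lp_coordinates_summable[OF co] by (simp add: lp_space_def)
  have zero: "(\<lambda>_. 0) \<in> lp_space p" by (simp add: lp_space_def)
  have "\<exists>\<delta>>0. \<forall>N. \<exists>n\<ge>N. \<delta> \<le> (\<Sum>k. \<bar>u (d n) k\<bar> powr p)"
  proof (rule ccontr)
    assume "\<not> ?thesis"
    then have ev: "\<exists>N. \<forall>n\<ge>N. (\<Sum>k. \<bar>u (d n) k\<bar> powr p) < \<delta>" if "0 < \<delta>" for \<delta>
      using that by (meson not_le)
    have "limitin (lp_topology p) (\<lambda>n. u (d n)) (\<lambda>_. 0) sequentially"
      unfolding lp_topology_def M.limitin_metric
    proof (intro conjI allI impI zero)
      fix \<epsilon> :: real assume \<epsilon>: "0 < \<epsilon>"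
      obtain N where N: "\<And>n. N \<le> n \<Longrightarrow> (\<Sum>k. \<bar>u (d n) k\<bar> powr p) < \<epsilon> powr p"
        using ev[of "\<epsilon> powr p"] \<epsilon> by auto
      have "lp_dist p (u (d n)) (\<lambda>_. 0) < \<epsilon>" if "N \<le> n" for n
      proof -
        have "(\<Sum>k. \<bar>u (d n) k\<bar> powr p) powr (1 / p) < (\<epsilon> powr p) powr (1 / p)"
          using N[OF that] p mem[of "d n"]
          by (intro powr_less_mono2 suminf_nonneg) (auto simp: lp_space_def)
        then show ?thesis using p \<epsilon> by (simp add: lp_dist_def lp_norm_def powr_powr)
      qed
      then show "\<forall>\<^sub>F n in sequentially. u (d n) \<in> lp_space p \<and> lp_dist p (u (d n)) (\<lambda>_. 0) < \<epsilon>"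
        using mem by (auto simp: eventually_sequentially)
    qed
    then have "relatively_compactin (lp_topology p) (range (\<lambda>n. u (d n)))"
      using M.Hausdorff_space_mtopology mem
      by (intro relatively_compactin_sequence) (auto simp: lp_topology_def)
    then show False using nc by (simp add: image_image)
  qed
  then obtain \<delta> where \<delta>: "0 < \<delta>" "\<And>N. \<exists>n\<ge>N. \<delta> \<le> (\<Sum>k. \<bar>u (d n) k\<bar> powr p)" by blast
  define c where "c = (2 / \<delta>) powr (1 / p)"
  have c: "0 \<le> c" "c powr p = 2 / \<delta>" using \<delta>(1) p by (auto simp: c_def powr_powr)
  have "\<exists>n\<ge>N. 2 \<le> (\<Sum>k. \<bar>c * u (d n) k\<bar> powr p)" for N
  proof -
    obtain n where n: "N \<le> n" "\<delta> \<le> (\<Sum>k. \<bar>u (d n) k\<bar> powr p)" using \<delta>(2) by blast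
    have "(\<Sum>k. \<bar>c * u (d n) k\<bar> powr p) = (\<Sum>k. 2 / \<delta> * \<bar>u (d n) k\<bar> powr p)"
      using c by (simp add: abs_mult powr_mult)
    also have "\<dots> = 2 / \<delta> * (\<Sum>k. \<bar>u (d n) k\<bar> powr p)"
      by (rule suminf_mult[OF lp_coordinates_summable[OF co]])
    also have "\<dots> \<ge> 2 / \<delta> * \<delta>" using n(2) \<delta>(1) by (intro mult_left_mono) auto
    finally show ?thesis using n(1) \<delta>(1) by auto
  qed
  then show thesis using that[OF lp_coordinates_scale[OF co c(1)]] by blast
qed


section \<open>The gliding hump\<close>

text \<open>
  A form of the Hahn--Banach theorem: lower the seminorm to a sublinear functional that is linear
  along \<open>z\<close>, then take a linear functional below it.
\<close>

lemma functional_attaining_seminorm: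
  fixes q :: "'a::real_vector \<Rightarrow> real"
  assumes q: "sublinear q" and sym: "\<And>x. q (- x) = q x"
  obtains f where "linear f" "\<And>x. \<bar>f x\<bar> \<le> q x" "q z \<le> f z"
proof -
  obtain r where r: "sublinear r" "\<And>x. r x \<le> q x" "r (- z) \<le> - q z"
    using sublinear_shift[OF q] by metis
  obtain f where f: "linear f" "\<And>x. f x \<le> r x"
    using linear_below_sublinear[OF r(1)] by metis
  have le: "f x \<le> q x" for x using f(2)[of x] r(2)[of x] by linarith
  show thesis
  proof
    show "linear f" by (rule f(1))
    show "\<bar>f x\<bar> \<le> q x" for x
      using le[of x] le[of "- x"] sym[of x] linear_neg[OF f(1), of x] by simp
    show "q z \<le> f z" using f(2)[of "- z"] r(3) linear_neg[OF f(1), of z] by simp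
  qed
qed

text \<open>
  The seminorm is the \<open>\<ell>\<^sub>p\<close> norm of the coordinates in \<open>I\<close>, all others being set to zero.  A
  functional dominated by it depends on the coordinates in \<open>I\<close> only.
\<close>

lemma block_functional:
  fixes g :: "nat \<Rightarrow> 'a::real_vector \<Rightarrow> real"
  assumes p: "1 \<le> p" and I: "finite I" and lin: "\<And>k. linear (g k)"
    and z: "1 \<le> (\<Sum>k\<in>I. \<bar>g k z\<bar> powr p)"
  obtains f where "linear f" "\<And>x. \<bar>f x\<bar> powr p \<le> (\<Sum>k\<in>I. \<bar>g k x\<bar> powr p)" "1 \<le> f z"
proof -
  define v where "v x = (\<lambda>k. if k \<in> I then g k x else 0)" for x
  have sums: "(\<lambda>k. \<bar>v x k\<bar> powr p) sums (\<Sum>k\<in>I. \<bar>g k x\<bar> powr p)" for x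
    using sums_finite[OF I, of "\<lambda>k. \<bar>v x k\<bar> powr p"] by (simp add: v_def)
  then have mem: "v x \<in> lp_space p" for x by (auto simp: lp_space_def sums_iff)
  have norm: "lp_norm p (v x) powr p = (\<Sum>k\<in>I. \<bar>g k x\<bar> powr p)" for x
    using sums_unique[OF sums, of x] by (simp add: lp_norm_powr[OF p mem])
  have add: "v (x + y) = (\<lambda>k. v x k + v y k)" for x y
    by (auto simp: v_def linear_add[OF lin])
  have scale: "lp_norm p (v (c *\<^sub>R x)) = c * lp_norm p (v x)" if "0 \<le> c" for c x
  proof -
    have "(\<Sum>k. \<bar>v (c *\<^sub>R x) k\<bar> powr p) = (\<Sum>k. c powr p * \<bar>v x k\<bar> powr p)"
      using that by (intro suminf_cong) (simp add: v_def linear_scale[OF lin] abs_mult powr_mult)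
    also have "\<dots> = c powr p * (\<Sum>k. \<bar>v x k\<bar> powr p)"
      by (rule suminf_mult) (use sums in \<open>auto simp: sums_iff\<close>)
    finally show ?thesis using that p by (simp add: lp_norm_def powr_mult powr_powr)
  qed
  have "sublinear (\<lambda>x. lp_norm p (v x))"
    unfolding sublinear_def using Minkowski[OF p mem mem] scale by (simp add: add)
  moreover have "lp_norm p (v (- x)) = lp_norm p (v x)" for x
  proof -
    have "\<bar>v (- x) k\<bar> = \<bar>v x k\<bar>" for k by (simp add: v_def linear_neg[OF lin])
    then show ?thesis by (simp add: lp_norm_def)
  qed
  ultimately obtain f where f: "linear f" "\<And>x. \<bar>f x\<bar> \<le> lp_norm p (v x)" "lp_norm p (v z) \<le> f z"
    by (rule functional_attaining_seminorm) (rule that)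
  show thesis
  proof
    show "linear f" by (rule f(1))
    have "\<bar>f x\<bar> powr p \<le> lp_norm p (v x) powr p" for x
      using f(2) p by (intro powr_mono2) auto
    then show "\<bar>f x\<bar> powr p \<le> (\<Sum>k\<in>I. \<bar>g k x\<bar> powr p)" for x by (simp add: norm)
    have "1 \<le> lp_norm p (v z)"
    proof (rule ccontr)
      assume "\<not> 1 \<le> lp_norm p (v z)"
      then have "lp_norm p (v z) powr p < 1 powr p"
        using p by (intro powr_less_mono2) (auto simp: lp_norm_nonneg)
      then show False using z by (simp add: norm)
    qed
    then show "1 \<le> f z" using f(3) by linarith
  qed
qed

text \<open>
  The coordinates below \<open>K\<close> contribute little once \<open>n\<close> is large, as there are finitely many of them
  and each tends to zero along \<open>d\<close>; for the chosen \<open>n\<close> the coordinates from some \<open>K'\<close> on contribute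
  little because the series converges.  Each part is allowed \<open>1/16\<close>, so what lies outside of the
  block contributes at most \<open>1/8\<close>, and at least \<open>2 - 1/8\<close> remains inside.
\<close>

lemma exists_hump:
  fixes d :: "nat \<Rightarrow> 'a::real_normed_vector"
  assumes p: "1 \<le> p" and g: "lp_coordinates p g" and d: "weakly_null d"
    and large: "\<And>N. \<exists>n\<ge>N. 2 \<le> (\<Sum>k. \<bar>g k (d n)\<bar> powr p)"
  shows "\<exists>n K'. K \<le> K' \<and> 1 \<le> (\<Sum>k\<in>{K..<K'}. \<bar>g k (d n)\<bar> powr p) \<and>
    (\<forall>F. finite F \<longrightarrow> F \<inter> {K..<K'} = {} \<longrightarrow> (\<Sum>k\<in>F. \<bar>g k (d n)\<bar> powr p) \<le> 1 / 8)"
proof -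
  have "(\<lambda>n. \<Sum>k<K. \<bar>g k (d n)\<bar> powr p) \<longlonglongrightarrow> (\<Sum>k<K. 0)"
  proof (rule tendsto_sum)
    fix k
    have "(\<lambda>n. g k (d n)) \<longlonglongrightarrow> 0"
      using d lp_coordinates_bounded_linear[OF g] p by (simp add: weakly_null_def)
    then have "(\<lambda>n. \<bar>g k (d n)\<bar> powr p) \<longlonglongrightarrow> 0 powr p"
      using p by (intro tendsto_powr2) (auto intro: tendsto_rabs_zero)
    then show "(\<lambda>n. \<bar>g k (d n)\<bar> powr p) \<longlonglongrightarrow> 0" by simp
  qed
  then have "\<forall>\<^sub>F n in sequentially. (\<Sum>k<K. \<bar>g k (d n)\<bar> powr p) < 1 / 16"
    by (rule order_tendstoD) simp
  then obtain N where N: "\<And>n. N \<le> n \<Longrightarrow> (\<Sum>k<K. \<bar>g k (d n)\<bar> powr p) < 1 / 16"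
    by (auto simp: eventually_sequentially)
  obtain n where n: "N \<le> n" "2 \<le> (\<Sum>k. \<bar>g k (d n)\<bar> powr p)" using large by blast
  define a where "a k = \<bar>g k (d n)\<bar> powr p" for k
  have a: "summable a" "\<And>k. 0 \<le> a k"
    unfolding a_def by (rule lp_coordinates_summable[OF g]) simp
  have "(\<lambda>m. sum a {..<m}) \<longlonglongrightarrow> suminf a" using summable_LIMSEQ[OF a(1)] .
  then have "\<forall>\<^sub>F m in sequentially. suminf a - 1 / 16 < sum a {..<m}"
    by (rule order_tendstoD) simp
  then have "\<forall>\<^sub>F m in sequentially. suminf a - 1 / 16 < sum a {..<m} \<and> K \<le> m"
    by (intro eventually_conj eventually_ge_at_top)
  then obtain K' where K': "suminf a - 1 / 16 < sum a {..<K'}" "K \<le> K'"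
    using eventually_happens'[OF sequentially_bot] by blast
  have split: "sum a {..<K'} = sum a {..<K} + sum a {K..<K'}"
    using K'(2) by (simp add: ivl_disj_un_one sum.union_disjoint[symmetric] ivl_disj_int)
  have big: "suminf a - 1 / 8 < sum a {K..<K'}"
    using split K'(1) N[OF n(1)] by (simp add: a_def)
  have "sum a F \<le> 1 / 8" if F: "finite F" "F \<inter> {K..<K'} = {}" for F
  proof -
    have "sum a F + sum a {K..<K'} = sum a (F \<union> {K..<K'})"
      using F by (simp add: sum.union_disjoint)
    also have "\<dots> \<le> suminf a" using F(1) a by (intro sum_le_suminf) auto
    finally show ?thesis using big by linarith
  qed
  moreover have "1 \<le> sum a {K..<K'}" using big n(2) unfolding a_def[symmetric] by linarith
  ultimately show ?thesis using K'(2) unfolding a_def by blast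
qed

text \<open>
  Starting each hump where the previous one ends gives disjoint blocks \<open>I i\<close>.  Disjointness has two
  effects: the block functionals again form an operator into \<open>\<ell>\<^sub>p\<close>, and those with index other than
  \<open>i\<close> see only the part of the \<open>i\<close>-th vector outside of its own block.
\<close>

lemma gliding_hump:
  fixes d :: "nat \<Rightarrow> 'a::real_normed_vector"
  assumes p: "1 \<le> p" and g: "lp_coordinates p g" and d: "weakly_null d"
    and large: "\<And>N. \<exists>n\<ge>N. 2 \<le> (\<Sum>k. \<bar>g k (d n)\<bar> powr p)"
  obtains \<phi> r where "lp_coordinates p \<phi>" "\<And>i. 1 \<le> \<phi> i (d (r i))"
    "\<And>i F. finite F \<Longrightarrow> i \<notin> F \<Longrightarrow> (\<Sum>k\<in>F. \<bar>\<phi> k (d (r i))\<bar> powr p) \<le> 1 / 8"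
proof -
  obtain n K' where K': "\<And>K. K \<le> K' K" "\<And>K. 1 \<le> (\<Sum>k\<in>{K..<K' K}. \<bar>g k (d (n K))\<bar> powr p)"
    "\<And>K F. finite F \<Longrightarrow> F \<inter> {K..<K' K} = {} \<Longrightarrow> (\<Sum>k\<in>F. \<bar>g k (d (n K))\<bar> powr p) \<le> 1 / 8"
    using exists_hump[OF p g d large] by metis
  define \<kappa> where "\<kappa> i = (K' ^^ i) 0" for i
  define I where "I i = {\<kappa> i..<\<kappa> (Suc i)}" for i
  have Suc: "\<kappa> (Suc i) = K' (\<kappa> i)" for i by (simp add: \<kappa>_def)
  have mono: "mono \<kappa>" using K'(1) by (auto simp: incseq_Suc_iff Suc)
  have disj: "I i \<inter> I j = {}" if "i \<noteq> j" for i j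
  proof -
    have "\<kappa> (Suc i) \<le> \<kappa> j \<or> \<kappa> (Suc j) \<le> \<kappa> i"
      using that monoD[OF mono] by (metis Suc_leI linorder_neqE_nat)
    then show ?thesis by (auto simp: I_def)
  qed
  have lin: "linear (g k)" for k using g by (simp add: lp_coordinates_def)
  have "\<exists>f. linear f \<and> (\<forall>x. \<bar>f x\<bar> powr p \<le> (\<Sum>k\<in>I i. \<bar>g k x\<bar> powr p)) \<and> 1 \<le> f (d (n (\<kappa> i)))" for i
  proof -
    have "1 \<le> (\<Sum>k\<in>I i. \<bar>g k (d (n (\<kappa> i)))\<bar> powr p)" using K'(2) by (simp add: I_def Suc)
    from block_functional[OF p _ lin this] show ?thesis by (metis I_def finite_atLeastLessThan)
  qed
  then obtain \<phi> where \<phi>: "\<And>i. linear (\<phi> i)"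
    "\<And>i x. \<bar>\<phi> i x\<bar> powr p \<le> (\<Sum>k\<in>I i. \<bar>g k x\<bar> powr p)" "\<And>i. 1 \<le> \<phi> i (d (n (\<kappa> i)))"
    by metis
  have sum: "(\<Sum>j\<in>F. \<bar>\<phi> j x\<bar> powr p) \<le> (\<Sum>k\<in>(\<Union>j\<in>F. I j). \<bar>g k x\<bar> powr p)" if "finite F" for F x
  proof -
    have "(\<Sum>j\<in>F. \<bar>\<phi> j x\<bar> powr p) \<le> (\<Sum>j\<in>F. \<Sum>k\<in>I j. \<bar>g k x\<bar> powr p)"
      by (intro sum_mono \<phi>(2))
    also have "\<dots> = (\<Sum>k\<in>(\<Union>j\<in>F. I j). \<bar>g k x\<bar> powr p)"
      using that disj by (intro sum.UNION_disjoint[symmetric]) (auto simp: I_def)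
    finally show ?thesis .
  qed
  have fin: "finite (\<Union>j\<in>F. I j)" if "finite F" for F using that by (auto simp: I_def)
  show thesis
  proof
    obtain C where C: "0 \<le> C"
      "\<And>z F. finite F \<Longrightarrow> (\<Sum>k\<in>F. \<bar>g k z\<bar> powr p) \<le> (C * norm z) powr p"
      using g unfolding lp_coordinates_def by blast
    show "lp_coordinates p \<phi>"
      unfolding lp_coordinates_def
      using \<phi>(1) C(1) order_trans[OF sum C(2)[OF fin]] by (intro conjI allI exI[of _ C]) auto
    show "1 \<le> \<phi> i (d (n (\<kappa> i)))" for i by (rule \<phi>(3))
    show "(\<Sum>k\<in>F. \<bar>\<phi> k (d (n (\<kappa> i)))\<bar> powr p) \<le> 1 / 8" if F: "finite F" "i \<notin> F" for i F
    proof -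
      have "I j \<inter> I i = {}" if "j \<in> F" for j using disj[of j i] F(2) that by metis
      then have "(\<Union>j\<in>F. I j) \<inter> I i = {}" by blast
      then have "(\<Union>j\<in>F. I j) \<inter> {\<kappa> i..<K' (\<kappa> i)} = {}" by (simp only: I_def[of i] Suc)
      from order_trans[OF sum[OF F(1)] K'(3)[OF fin[OF F(1)] this]] show ?thesis .
    qed
  qed
qed


section \<open>Diagonal bilinear forms\<close>

text \<open>
  This is where \<open>1/p + 1/q \<ge> 1\<close> enters: with \<open>m\<close> the larger of the
  two powers, \<open>s * t \<le> m powr (1/p + 1/q) \<le> m\<close> because \<open>m \<le> 1\<close>.
\<close>

lemma mult_le_powr_add:
  fixes s t p q :: real
  assumes s: "0 \<le> s" "s \<le> 1" and t: "0 \<le> t" "t \<le> 1" and pq: "0 < p" "0 < q" "1 \<le> 1 / p + 1 / q"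
  shows "s * t \<le> s powr p + t powr q"
proof -
  define m where "m = max (s powr p) (t powr q)"
  have m: "0 \<le> m" "m \<le> 1" using s t pq by (auto simp: m_def powr_le1 le_max_iff_disj)
  have "s = (s powr p) powr (1 / p)" using s pq by (simp add: powr_powr)
  also have "\<dots> \<le> m powr (1 / p)" using pq by (intro powr_mono2) (auto simp: m_def)
  finally have 1: "s \<le> m powr (1 / p)" .
  have "t = (t powr q) powr (1 / q)" using t pq by (simp add: powr_powr)
  also have "\<dots> \<le> m powr (1 / q)" using pq by (intro powr_mono2) (auto simp: m_def)
  finally have "s * t \<le> m powr (1 / p) * m powr (1 / q)"
    using 1 s t by (intro mult_mono) auto
  also have "\<dots> = m powr (1 / p + 1 / q)" by (simp add: powr_add)
  also have "\<dots> \<le> m powr 1" using m pq by (intro powr_mono') auto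
  also have "\<dots> \<le> s powr p + t powr q" using m by (auto simp: m_def)
  finally show ?thesis .
qed

lemma sum_mult_le_powr_add:
  fixes s t :: "nat \<Rightarrow> real"
  assumes pq: "0 < p" "0 < q" "1 \<le> 1 / p + 1 / q" and F: "finite F"
    and s: "(\<Sum>k\<in>F. \<bar>s k\<bar> powr p) \<le> 1" and t: "(\<Sum>k\<in>F. \<bar>t k\<bar> powr q) \<le> 1"
  shows "(\<Sum>k\<in>F. \<bar>s k * t k\<bar>) \<le> (\<Sum>k\<in>F. \<bar>s k\<bar> powr p) + (\<Sum>k\<in>F. \<bar>t k\<bar> powr q)"
proof -
  have le1: "\<bar>v k\<bar> \<le> 1" if "k \<in> F" "(\<Sum>k\<in>F. \<bar>v k\<bar> powr a) \<le> 1" "0 < a" for v :: "nat \<Rightarrow> real" and k a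
  proof (rule ccontr)
    assume "\<not> \<bar>v k\<bar> \<le> 1"
    then have "1 powr a < \<bar>v k\<bar> powr a" using that by (intro powr_less_mono2) auto
    also have "\<dots> \<le> (\<Sum>k\<in>F. \<bar>v k\<bar> powr a)" by (rule member_le_sum) (use that F in auto)
    finally show False using that by simp
  qed
  have "\<bar>s k * t k\<bar> \<le> \<bar>s k\<bar> powr p + \<bar>t k\<bar> powr q" if "k \<in> F" for k
    unfolding abs_mult by (rule mult_le_powr_add) (use le1 that s t pq in auto)
  then show ?thesis by (simp add: sum_mono flip: sum.distrib)
qed

lemma sum_mult_bound:
  fixes s t :: "nat \<Rightarrow> real"
  assumes pq: "0 < p" "0 < q" "1 \<le> 1 / p + 1 / q" and F: "finite F"
    and a: "0 < a" "(\<Sum>k\<in>F. \<bar>s k\<bar> powr p) \<le> a powr p"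
    and b: "0 < b" "(\<Sum>k\<in>F. \<bar>t k\<bar> powr q) \<le> b powr q"
  shows "(\<Sum>k\<in>F. \<bar>s k * t k\<bar>) \<le> 2 * (a * b)"
proof -
  have 1: "(\<Sum>k\<in>F. \<bar>v k / c\<bar> powr e) \<le> 1"
    if "(\<Sum>k\<in>F. \<bar>v k\<bar> powr e) \<le> c powr e" "0 < c" for v :: "nat \<Rightarrow> real" and c e
    using that by (simp add: abs_divide powr_divide divide_le_eq flip: sum_divide_distrib)
  have "(\<Sum>k\<in>F. \<bar>s k * t k\<bar>) / (a * b) = (\<Sum>k\<in>F. \<bar>s k / a * (t k / b)\<bar>)"
    using a b by (simp add: sum_divide_distrib abs_mult)
  also have "\<dots> \<le> (\<Sum>k\<in>F. \<bar>s k / a\<bar> powr p) + (\<Sum>k\<in>F. \<bar>t k / b\<bar> powr q)"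
    by (rule sum_mult_le_powr_add[OF pq F 1 1]) (use a b in auto)
  also have "\<dots> \<le> 2" using 1[OF a(2,1)] 1[OF b(2,1)] by linarith
  finally show ?thesis using a b by (simp add: divide_le_eq)
qed

definition diagonal_form ::
    "(nat \<Rightarrow> real) \<Rightarrow> (nat \<Rightarrow> 'a \<Rightarrow> real) \<Rightarrow> (nat \<Rightarrow> 'b \<Rightarrow> real) \<Rightarrow> 'a \<Rightarrow> 'b \<Rightarrow> real" where
  "diagonal_form \<theta> \<phi> \<psi> x y = (\<Sum>k. \<theta> k * (\<phi> k x * \<psi> k y))"

lemma diagonal_form_bounds:
  fixes \<phi> :: "nat \<Rightarrow> 'a::real_normed_vector \<Rightarrow> real" and \<psi> :: "nat \<Rightarrow> 'b::real_normed_vector \<Rightarrow> real"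
  assumes pq: "0 < p" "0 < q" "1 \<le> 1 / p + 1 / q"
    and \<phi>: "lp_coordinates p \<phi>" and \<psi>: "lp_coordinates q \<psi>"
  obtains C where "0 \<le> C"
    "\<And>x y F. finite F \<Longrightarrow> (\<Sum>k\<in>F. \<bar>\<phi> k x * \<psi> k y\<bar>) \<le> C * (norm x * norm y)"
proof -
  obtain A where A: "0 \<le> A"
    "\<And>z F. finite F \<Longrightarrow> (\<Sum>k\<in>F. \<bar>\<phi> k z\<bar> powr p) \<le> (A * norm z) powr p"
    using \<phi> unfolding lp_coordinates_def by blast
  obtain B where B: "0 \<le> B"
    "\<And>z F. finite F \<Longrightarrow> (\<Sum>k\<in>F. \<bar>\<psi> k z\<bar> powr q) \<le> (B * norm z) powr q"
    using \<psi> unfolding lp_coordinates_def by blast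
  have lin: "linear (\<phi> k)" "linear (\<psi> k)" for k using \<phi> \<psi> by (auto simp: lp_coordinates_def)
  show thesis
  proof
    \<comment> \<open>Adding \<open>1\<close> makes both constants positive, so that the sequences can be normalised.\<close>
    show "0 \<le> 2 * ((A + 1) * (B + 1))" using A(1) B(1) by simp
    fix x y and F :: "nat set" assume F: "finite F"
    show "(\<Sum>k\<in>F. \<bar>\<phi> k x * \<psi> k y\<bar>) \<le> 2 * ((A + 1) * (B + 1)) * (norm x * norm y)"
    proof (cases "x = 0 \<or> y = 0")
      case True
      then have "\<phi> k x * \<psi> k y = 0" for k using linear_0[OF lin(1)] linear_0[OF lin(2)] by auto
      then show ?thesis using True by (simp only: abs_zero) auto
    next
      case False
      have "(A * norm x) powr p \<le> ((A + 1) * norm x) powr p"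
        using pq A(1) by (intro powr_mono2 mult_right_mono mult_nonneg_nonneg) auto
      moreover have "(B * norm y) powr q \<le> ((B + 1) * norm y) powr q"
        using pq B(1) by (intro powr_mono2 mult_right_mono mult_nonneg_nonneg) auto
      ultimately have "(\<Sum>k\<in>F. \<bar>\<phi> k x * \<psi> k y\<bar>) \<le> 2 * (((A + 1) * norm x) * ((B + 1) * norm y))"
        using A(1) B(1) False order_trans[OF A(2)[OF F]] order_trans[OF B(2)[OF F]]
        by (intro sum_mult_bound[OF pq F]) auto
      then show ?thesis by (simp add: algebra_simps)
    qed
  qed
qed

lemma bounded_bilinear_diagonal_form:
  fixes \<phi> :: "nat \<Rightarrow> 'a::real_normed_vector \<Rightarrow> real" and \<psi> :: "nat \<Rightarrow> 'b::real_normed_vector \<Rightarrow> real"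
  assumes pq: "0 < p" "0 < q" "1 \<le> 1 / p + 1 / q"
    and \<phi>: "lp_coordinates p \<phi>" and \<psi>: "lp_coordinates q \<psi>" and \<theta>: "\<And>k. \<bar>\<theta> k\<bar> \<le> 1"
  shows "summable (\<lambda>k. \<theta> k * (\<phi> k x * \<psi> k y))" and "bounded_bilinear (diagonal_form \<theta> \<phi> \<psi>)"
proof -
  obtain C where C: "0 \<le> C"
    "\<And>x y F. finite F \<Longrightarrow> (\<Sum>k\<in>F. \<bar>\<phi> k x * \<psi> k y\<bar>) \<le> C * (norm x * norm y)"
    by (rule diagonal_form_bounds[OF pq \<phi> \<psi>]) (rule that)
  have lin: "linear (\<phi> k)" "linear (\<psi> k)" for k using \<phi> \<psi> by (auto simp: lp_coordinates_def)
  have bound: "(\<Sum>k\<in>F. \<bar>\<theta> k * (\<phi> k x * \<psi> k y)\<bar>) \<le> C * (norm x * norm y)" if "finite F" for F x y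
  proof -
    have "\<bar>\<theta> k * (\<phi> k x * \<psi> k y)\<bar> \<le> \<bar>\<phi> k x * \<psi> k y\<bar>" for k
      using mult_right_mono[OF \<theta>, of "\<bar>\<phi> k x * \<psi> k y\<bar>" k] by (simp add: abs_mult)
    then have "(\<Sum>k\<in>F. \<bar>\<theta> k * (\<phi> k x * \<psi> k y)\<bar>) \<le> (\<Sum>k\<in>F. \<bar>\<phi> k x * \<psi> k y\<bar>)"
      by (rule sum_mono)
    also note C(2)[OF that]
    finally show ?thesis .
  qed
  have abs: "summable (\<lambda>k. \<bar>\<theta> k * (\<phi> k x * \<psi> k y)\<bar>)" for x y
    by (rule bounded_imp_summable[OF _ bound]) auto
  have summable: "summable (\<lambda>k. \<theta> k * (\<phi> k x * \<psi> k y))" for x y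
    using abs by (rule summable_rabs_cancel)
  then show "summable (\<lambda>k. \<theta> k * (\<phi> k x * \<psi> k y))" .
  show "bounded_bilinear (diagonal_form \<theta> \<phi> \<psi>)"
  proof
    fix x x' :: 'a and y y' :: 'b and c :: real
    show "diagonal_form \<theta> \<phi> \<psi> (x + x') y = diagonal_form \<theta> \<phi> \<psi> x y + diagonal_form \<theta> \<phi> \<psi> x' y"
      unfolding diagonal_form_def suminf_add[OF summable summable]
      by (simp add: linear_add[OF lin(1)] algebra_simps)
    show "diagonal_form \<theta> \<phi> \<psi> x (y + y') = diagonal_form \<theta> \<phi> \<psi> x y + diagonal_form \<theta> \<phi> \<psi> x y'"
      unfolding diagonal_form_def suminf_add[OF summable summable]
      by (simp add: linear_add[OF lin(2)] algebra_simps)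
    show "diagonal_form \<theta> \<phi> \<psi> (c *\<^sub>R x) y = c *\<^sub>R diagonal_form \<theta> \<phi> \<psi> x y"
      unfolding diagonal_form_def real_scaleR_def suminf_mult[OF summable, symmetric]
      by (simp add: linear_scale[OF lin(1)] mult_ac)
    show "diagonal_form \<theta> \<phi> \<psi> x (c *\<^sub>R y) = c *\<^sub>R diagonal_form \<theta> \<phi> \<psi> x y"
      unfolding diagonal_form_def real_scaleR_def suminf_mult[OF summable, symmetric]
      by (simp add: linear_scale[OF lin(2)] mult_ac)
    show "\<exists>K. \<forall>x y. norm (diagonal_form \<theta> \<phi> \<psi> x y) \<le> norm x * norm y * K"
    proof (intro exI allI)
      fix x y
      have "\<bar>diagonal_form \<theta> \<phi> \<psi> x y\<bar> \<le> (\<Sum>k. \<bar>\<theta> k * (\<phi> k x * \<psi> k y)\<bar>)"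
        unfolding diagonal_form_def by (rule summable_rabs[OF abs])
      also have "\<dots> \<le> C * (norm x * norm y)"
        by (rule suminf_le_const[OF abs]) (rule bound, simp)
      finally show "norm (diagonal_form \<theta> \<phi> \<psi> x y) \<le> norm x * norm y * C" by (simp add: mult.commute)
    qed
  qed
qed

text \<open>
  The off-diagonal sums are below \<open>1\<close>, so the inequality for sequences in the unit balls applies
  directly and bounds the off-diagonal part by \<open>1/8 + 1/8\<close>.
\<close>

lemma diagonal_form_near_diagonal:
  fixes \<phi> :: "nat \<Rightarrow> 'a::real_normed_vector \<Rightarrow> real" and \<psi> :: "nat \<Rightarrow> 'b::real_normed_vector \<Rightarrow> real"
  assumes pq: "0 < p" "0 < q" "1 \<le> 1 / p + 1 / q"
    and \<phi>: "lp_coordinates p \<phi>" and \<psi>: "lp_coordinates q \<psi>" and \<theta>: "\<And>k. \<bar>\<theta> k\<bar> \<le> 1"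
    and x: "\<And>F. finite F \<Longrightarrow> i \<notin> F \<Longrightarrow> (\<Sum>k\<in>F. \<bar>\<phi> k x\<bar> powr p) \<le> 1 / 8"
    and y: "\<And>F. finite F \<Longrightarrow> i \<notin> F \<Longrightarrow> (\<Sum>k\<in>F. \<bar>\<psi> k y\<bar> powr q) \<le> 1 / 8"
  shows "\<bar>diagonal_form \<theta> \<phi> \<psi> x y - \<theta> i * (\<phi> i x * \<psi> i y)\<bar> \<le> 1 / 4"
proof -
  define h where "h k = \<theta> k * (\<phi> k x * \<psi> k y)" for k
  have "h sums diagonal_form \<theta> \<phi> \<psi> x y"
    unfolding h_def diagonal_form_def
    by (rule summable_sums[OF bounded_bilinear_diagonal_form(1)[OF pq \<phi> \<psi> \<theta>]])
  then have lim: "(\<lambda>n. sum h {..<n} - h i) \<longlonglongrightarrow> diagonal_form \<theta> \<phi> \<psi> x y - h i"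
    unfolding sums_def by (intro tendsto_diff) auto
  have "\<bar>sum h {..<n} - h i\<bar> \<le> 1 / 4" if "i < n" for n
  proof -
    define F where "F = {..<n} - {i}"
    have F: "finite F" "i \<notin> F" by (auto simp: F_def)
    have "sum h {..<n} - h i = sum h F" using that by (simp add: F_def sum_diff1)
    then have "\<bar>sum h {..<n} - h i\<bar> \<le> (\<Sum>k\<in>F. \<bar>h k\<bar>)" by (simp add: sum_abs)
    also have "\<dots> \<le> (\<Sum>k\<in>F. \<bar>\<phi> k x * \<psi> k y\<bar>)"
    proof (rule sum_mono)
      fix k show "\<bar>h k\<bar> \<le> \<bar>\<phi> k x * \<psi> k y\<bar>"
        using mult_right_mono[OF \<theta>, of "\<bar>\<phi> k x * \<psi> k y\<bar>" k] by (simp add: h_def abs_mult)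
    qed
    also have "\<dots> \<le> (\<Sum>k\<in>F. \<bar>\<phi> k x\<bar> powr p) + (\<Sum>k\<in>F. \<bar>\<psi> k y\<bar> powr q)"
      by (rule sum_mult_le_powr_add[OF pq F(1)]) (use x[OF F] y[OF F] in auto)
    also have "\<dots> \<le> 1 / 4" using x[OF F] y[OF F] by linarith
    finally show ?thesis .
  qed
  then have "\<exists>N. \<forall>n\<ge>N. \<bar>sum h {..<n} - h i\<bar> \<le> 1 / 4" by (intro exI[of _ "Suc i"]) auto
  then show ?thesis
    unfolding h_def[of i, symmetric] by (rule LIMSEQ_le_const2[OF tendsto_rabs[OF lim]])
qed


section \<open>Property (R) implies property (AW)\<close>

text \<open>
  All that is needed from one factor: differences of elements of \<open>W\<close> with functionals that are
  almost biorthogonal to them and form an operator into \<open>\<ell>\<^sub>p\<close>.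
\<close>

lemma property_R_almost_biorthogonal_differences:
  fixes W :: "'a::banach set"
  assumes R: "property_R p TYPE('a)" and p: "1 \<le> p"
    and W: "weakly_precompact W" and nc: "\<not> relatively_compactin euclidean W"
  obtains x x' \<phi> where "\<And>n. x n \<in> W" "\<And>n. x' n \<in> W" "lp_coordinates p \<phi>"
    "\<And>i. 1 \<le> \<phi> i (x i - x' i)"
    "\<And>i F. finite F \<Longrightarrow> i \<notin> F \<Longrightarrow> (\<Sum>k\<in>F. \<bar>\<phi> k (x i - x' i)\<bar> powr p) \<le> 1 / 8"
proof -
  obtain x x' e where x: "\<And>n. x n \<in> W" "\<And>n. x' n \<in> W"
    and d: "weakly_null (\<lambda>n. x n - x' n)" "0 < e" "\<And>n. e \<le> norm (x n - x' n)"
    by (rule weakly_null_differences[OF W nc]) (rule that)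
  obtain g where g: "lp_coordinates p g"
    "\<And>N. \<exists>n\<ge>N. 2 \<le> (\<Sum>k. \<bar>g k (x n - x' n)\<bar> powr p)"
    by (rule property_R_coordinates[OF R p d]) (rule that)
  obtain \<phi> r where \<phi>: "lp_coordinates p \<phi>" "\<And>i. 1 \<le> \<phi> i (x (r i) - x' (r i))"
    "\<And>i F. finite F \<Longrightarrow> i \<notin> F \<Longrightarrow> (\<Sum>k\<in>F. \<bar>\<phi> k (x (r i) - x' (r i))\<bar> powr p) \<le> 1 / 8"
    by (rule gliding_hump[OF p g(1) d(1) g(2)]) (rule that)
  show thesis by (rule that[of "\<lambda>i. x (r i)" "\<lambda>i. x' (r i)", OF x(1) x(2) \<phi>])
qed

lemma weakly_precompact_common_subsequence:
  fixes s :: "'i \<Rightarrow> nat \<Rightarrow> 'a::real_normed_vector"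
  assumes A: "weakly_precompact A" and I: "finite I" and s: "\<And>i n. i \<in> I \<Longrightarrow> s i n \<in> A"
  obtains r where "strict_mono (r :: nat \<Rightarrow> nat)" "\<And>i. i \<in> I \<Longrightarrow> weakly_Cauchy (s i \<circ> r)"
proof -
  have "\<exists>r. strict_mono (r :: nat \<Rightarrow> nat) \<and> (\<forall>i\<in>I. weakly_Cauchy (s i \<circ> r))"
    using I s
  proof (induction I)
    case empty
    show ?case by (auto intro: strict_mono_id exI[of _ id])
  next
    case (insert i I)
    then have "\<exists>r. strict_mono (r :: nat \<Rightarrow> nat) \<and> (\<forall>j\<in>I. weakly_Cauchy (s j \<circ> r))"
      by blast
    then obtain r where r: "strict_mono (r :: nat \<Rightarrow> nat)" "\<And>j. j \<in> I \<Longrightarrow> weakly_Cauchy (s j \<circ> r)"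
      by blast
    have "range (s i \<circ> r) \<subseteq> A" using insert.prems by auto
    then obtain r' where r': "strict_mono (r' :: nat \<Rightarrow> nat)" "weakly_Cauchy ((s i \<circ> r) \<circ> r')"
      using A unfolding weakly_precompact_def by blast
    have "weakly_Cauchy (s j \<circ> (r \<circ> r'))" if "j \<in> I" for j
      using r(2)[OF that] Cauchy_subseq_Cauchy[OF _ r'(1)]
      unfolding weakly_Cauchy_def by (fastforce simp: o_def)
    then show ?case
      using r'(2) strict_mono_o[OF r(1) r'(1)]
      by (intro exI[of _ "r \<circ> r'"]) (simp add: o_assoc del: o_apply)
  qed
  then show thesis using that by blast
qed

text \<open>
  By bilinearity \<open>(x - x') \<otimes> (y - y')\<close> is a combination of four elementary tensors of \<open>W\<^sub>1 \<otimes> W\<^sub>2\<close>, and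
  finitely many sequences in a weakly precompact set share the indices of weakly Cauchy
  subsequences.
\<close>

lemma weakly_precompact_tensor_differences:
  assumes W: "weakly_precompact {x \<otimes>\<^sub>\<pi> y | x y. x \<in> W\<^sub>1 \<and> y \<in> W\<^sub>2}"
    and x: "\<And>n :: nat. x n \<in> W\<^sub>1" "\<And>n. x' n \<in> W\<^sub>1" and y: "\<And>n. y n \<in> W\<^sub>2" "\<And>n. y' n \<in> W\<^sub>2"
  obtains r where "strict_mono (r :: nat \<Rightarrow> nat)"
    "\<And>B :: _ \<Rightarrow> _ \<Rightarrow> real. bounded_bilinear B \<Longrightarrow>
      Cauchy (\<lambda>n. B (x (r n) - x' (r n)) (y (r n) - y' (r n)))"
proof -
  \<comment> \<open>The four sequences are indexed by pairs of truth values.\<close>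
  define s where "s i n = (if fst i then x n else x' n) \<otimes>\<^sub>\<pi> (if snd i then y n else y' n)" for i n
  obtain r where r: "strict_mono (r :: nat \<Rightarrow> nat)" "\<And>i. weakly_Cauchy (s i \<circ> r)"
  proof (rule weakly_precompact_common_subsequence[OF W, of UNIV s])
    show "s i n \<in> {x \<otimes>\<^sub>\<pi> y | x y. x \<in> W\<^sub>1 \<and> y \<in> W\<^sub>2}" for i n
      unfolding s_def using x[of n] y[of n] by (cases "fst i"; cases "snd i") auto
  qed (use that in auto)
  have "Cauchy (\<lambda>n. B (x (r n) - x' (r n)) (y (r n) - y' (r n)))"
    if B: "bounded_bilinear B" for B :: "_ \<Rightarrow> _ \<Rightarrow> real"
  proof -
    obtain L where L: "bounded_linear L" "\<And>x y. L (x \<otimes>\<^sub>\<pi> y) = B x y"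
      by (rule bounded_bilinear_on_projective_tensor[OF B]) (rule that)
    have C: "Cauchy (\<lambda>n. B (if a then x (r n) else x' (r n)) (if b then y (r n) else y' (r n)))" for a b
      using r(2)[of "(a, b)"] L by (auto simp: weakly_Cauchy_def s_def)
    have "Cauchy (\<lambda>n. (B (x (r n)) (y (r n)) - B (x' (r n)) (y (r n)))
        - (B (x (r n)) (y' (r n)) - B (x' (r n)) (y' (r n))))"
      using C[of True True] C[of True False] C[of False True] C[of False False]
      by (intro Cauchy_diff) auto
    then show ?thesis
      by (simp add: bounded_bilinear.diff_left[OF B] bounded_bilinear.diff_right[OF B])
  qed
  then show thesis using that r(1) by blast
qed

theorem theorem3p4:
  fixes p q :: real
  assumes "1 < p" and "1 < q" and "1 / p + 1 / q \<ge> 1"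
    and "property_R p TYPE('a::banach)" and "property_R q TYPE('b::banach)"
  shows "property_AW TYPE('a) TYPE('b)"
  unfolding property_AW_def
proof (intro allI impI, rule ccontr)
  fix W\<^sub>1 :: "'a set" and W\<^sub>2 :: "'b set"
  assume W: "weakly_precompact {x \<otimes>\<^sub>\<pi> y | x y. x \<in> W\<^sub>1 \<and> y \<in> W\<^sub>2}"
    and "\<not> (relatively_compactin euclidean W\<^sub>1 \<or> relatively_compactin euclidean W\<^sub>2)"
  then have nc1: "\<not> relatively_compactin euclidean W\<^sub>1" and nc2: "\<not> relatively_compactin euclidean W\<^sub>2"
    by auto
  have nz: "\<exists>w\<in>V. w \<noteq> 0" if "\<not> relatively_compactin euclidean V" for V :: "'c::banach set"
  proof (rule ccontr)
    assume "\<not> ?thesis"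
    then have "V = {} \<or> V = {0}" by auto
    then show False using that by (auto simp: relatively_compactin_def)
  qed
  have wp1: "weakly_precompact W\<^sub>1"
    using weakly_precompact_tensor_factors(1)[OF W] nz[OF nc2] by blast
  have wp2: "weakly_precompact W\<^sub>2"
    using weakly_precompact_tensor_factors(2)[OF W] nz[OF nc1] by blast
  have pq: "1 \<le> p" "1 \<le> q" "0 < p" "0 < q" "1 \<le> 1 / p + 1 / q" using assms(1-3) by auto
  obtain x x' \<phi> where x: "\<And>n. x n \<in> W\<^sub>1" "\<And>n. x' n \<in> W\<^sub>1" and \<phi>: "lp_coordinates p \<phi>"
    "\<And>i. 1 \<le> \<phi> i (x i - x' i)"
    "\<And>i F. finite F \<Longrightarrow> i \<notin> F \<Longrightarrow> (\<Sum>k\<in>F. \<bar>\<phi> k (x i - x' i)\<bar> powr p) \<le> 1 / 8"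
    by (rule property_R_almost_biorthogonal_differences[OF assms(4) pq(1) wp1 nc1]) (rule that)
  obtain y y' \<psi> where y: "\<And>n. y n \<in> W\<^sub>2" "\<And>n. y' n \<in> W\<^sub>2" and \<psi>: "lp_coordinates q \<psi>"
    "\<And>i. 1 \<le> \<psi> i (y i - y' i)"
    "\<And>i F. finite F \<Longrightarrow> i \<notin> F \<Longrightarrow> (\<Sum>k\<in>F. \<bar>\<psi> k (y i - y' i)\<bar> powr q) \<le> 1 / 8"
    by (rule property_R_almost_biorthogonal_differences[OF assms(5) pq(2) wp2 nc2]) (rule that)
  obtain r where r: "strict_mono (r :: nat \<Rightarrow> nat)"
    "\<And>B :: _ \<Rightarrow> _ \<Rightarrow> real. bounded_bilinear B \<Longrightarrow>
      Cauchy (\<lambda>n. B (x (r n) - x' (r n)) (y (r n) - y' (r n)))"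
    by (rule weakly_precompact_tensor_differences[OF W x y]) (rule that)
  \<comment> \<open>The weights depend on \<open>r\<close>; this is harmless, as \<open>r\<close> serves all bounded bilinear forms at once.\<close>
  define \<theta> :: "nat \<Rightarrow> real" where "\<theta> k = (if k \<in> range (\<lambda>i. r (2 * i)) then 1 else 0)" for k
  have \<theta>: "\<bar>\<theta> k\<bar> \<le> 1" for k by (simp add: \<theta>_def)
  have even: "\<theta> (r (2 * i)) = 1" for i by (simp add: \<theta>_def)
  have odd: "\<theta> (r (Suc (2 * i))) = 0" for i
  proof -
    have "r (Suc (2 * i)) \<noteq> r (2 * j)" for j
      using injD[OF strict_mono_imp_inj_on[OF r(1)], of "Suc (2 * i)" "2 * j"] by presburger
    then show ?thesis by (auto simp: \<theta>_def)
  qed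
  define b where "b n = diagonal_form \<theta> \<phi> \<psi> (x (r n) - x' (r n)) (y (r n) - y' (r n))" for n
  have near: "\<bar>b n - \<theta> (r n) *
      (\<phi> (r n) (x (r n) - x' (r n)) * \<psi> (r n) (y (r n) - y' (r n)))\<bar> \<le> 1 / 4" for n
    unfolding b_def by (rule diagonal_form_near_diagonal[OF pq(3-5) \<phi>(1) \<psi>(1) \<theta> \<phi>(3) \<psi>(3)])
  have b_even: "3 / 4 \<le> b (2 * i)" for i
  proof -
    have "1 * 1 \<le> \<phi> (r (2 * i)) (x (r (2 * i)) - x' (r (2 * i)))
        * \<psi> (r (2 * i)) (y (r (2 * i)) - y' (r (2 * i)))"
      using \<phi>(2)[of "r (2 * i)"] \<psi>(2)[of "r (2 * i)"] by (intro mult_mono) auto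
    then show ?thesis using near[of "2 * i"] unfolding even by linarith
  qed
  have b_odd: "b (Suc (2 * i)) \<le> 1 / 4" for i using near[of "Suc (2 * i)"] unfolding odd by linarith
  have "Cauchy b"
    unfolding b_def
    by (rule r(2)[OF bounded_bilinear_diagonal_form(2)[OF pq(3-5) \<phi>(1) \<psi>(1) \<theta>]])
  then obtain N where N: "\<And>m n. N \<le> m \<Longrightarrow> N \<le> n \<Longrightarrow> norm (b m - b n) < 1 / 2"
    using CauchyD[of b "1 / 2"] by auto
  show False using N[of "2 * N" "Suc (2 * N)"] b_even[of N] b_odd[of N] by simp
qed

end
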